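(* Let $G$ be a finite abelian group with $|G|\ge 3$. (1) For every $k_0\in\mathbb N$, $$\lim_{n\to\infty}\frac{\bigl|\{A\in\mathcal B_\rho(G): n-k_0\in\mathsf L_{\mathcal B_\rho(G)}(A)\}\bigr|}{\bigl|\{A\in\mathcal B_\rho(G): n\in\mathsf L_{\mathcal B_\rho(G)}(A)\}\bigr|}=1.$$ (2) Suppose that there are $g_1,g_2\in G$ and minimal zero-sum sequences $U_1,U_2$ over $G$ such that $|U_1|=|U_2|=\mathsf D(G)$, $g_1g_2\mid U_1$ and $(g_1+g_2)\mid U_2$ (divisibility in $\mathcal F(G)$). Then $$\lim_{n\to\infty}\frac{\bigl|\{A\in\mathcal B_\rho(G): \mathsf L(A)\text{ is an interval and } n\in\mathsf L_{\mathcal B_\rho(G)}(A)\}\bigr|}{\bigl|\{A\in\mathcal B_\rho(G): n\in\mathsf L_{\mathcal B_\rho(G)}(A)\}\bigr|}=1.$$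
   Context: For a finite abelian group $G$ (written additively), $\mathcal F(G)$ is the free abelian monoid with basis $G$ (written multiplicatively), whose elements are called sequences over $G$. For $S=g_1\cdots g_\ell\in\mathcal F(G)$, $|S|=\ell$ is its length and $\sigma(S)=g_1+\dots+g_\ell$ its sum. $\mathcal B(G)=\{S\in\mathcal F(G):\sigma(S)=0\}$ is the monoid of zero-sum sequences over $G$; $\mathcal A(G)$ is its set of atoms (irreducible elements), called minimal zero-sum sequences over $G$. The Davenport constant is $\mathsf D(G)=\max\{|U|:U\in\mathcal A(G)\}$. For a monoid $B$ and a non-unit $A\in B$, $\mathsf L_B(A)$ is the set of all $k\in\mathbb N$ such that $A$ is a product of $k$ atoms of $B$; $\mathsf L_B(A)=\{0\}$ if $A$ is a unit. For $A\in\mathcal B(G)$, $\mathsf L(A)=\mathsf L_{\mathcal B(G)}(A)$. For a finite nonempty $L\subset\mathbb N$, $\rho(L)=\max L/\min L$; $\rho(\mathcal B(G))=\sup\rho(\mathsf L(A))$ over all non-identity $A\in\mathcal B(G)$ (it is known that for $|G|\ge 3$ this equals $\mathsf D(G)/2$). $\mathcal B_\rho(G)$ is the set consisting of the identity element of $\mathcal B(G)$ and all $A\in\mathcal B(G)$ with $\rho(\mathsf L(A))=\rho(\mathcal B(G))$; it is a submonoid of $\mathcal B(G)$, and $\mathsf L_{\mathcal B_\rho(G)}(A)$ is the length set of $A$ with respect to the atoms of the monoid $\mathcal B_\rho(G)$. An interval is a finite nonempty set of consecutive integers. *)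

theory Defs
  imports Complex_Main "HOL-Library.Multiset" "HOL-Library.Cardinality"
begin

text \<open>
  A finite abelian group is a type of class \<open>{ab_group_add, finite}\<close>.  The free abelian monoid over
  it is the type of multisets over it: the product of sequences is \<open>+\<close>, the identity is \<open>{#}\<close>,
  divisibility is \<open>\<subseteq>#\<close>, length is \<open>size\<close> and the sum of a sequence is \<open>sum_mset\<close>.

  The factorization-theoretic notions are defined for an arbitrary submonoid \<open>B\<close>, given by its
  carrier, of a commutative monoid written additively.  Units and atoms are those of \<open>B\<close> itself,
  not of the ambient monoid.
\<close>

definition units_in :: "'a::comm_monoid_add set \<Rightarrow> 'a set" where
  "units_in B = {u \<in> B. \<exists>v\<in>B. u + v = 0}"

definition atoms_in :: "'a::comm_monoid_add set \<Rightarrow> 'a set" where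
  "atoms_in B = {u \<in> B. u \<notin> units_in B \<and>
     (\<forall>x\<in>B. \<forall>y\<in>B. u = x + y \<longrightarrow> x \<in> units_in B \<or> y \<in> units_in B)}"

definition length_set :: "'a::comm_monoid_add set \<Rightarrow> 'a \<Rightarrow> nat set" where
  "length_set B a = (if a \<in> units_in B then {0}
     else {k. \<exists>us. set us \<subseteq> atoms_in B \<and> length us = k \<and> sum_list us = a})"

definition elasticity :: "nat set \<Rightarrow> real" where
  "elasticity L = real (Max L) / real (Min L)"

definition is_interval_set :: "nat set \<Rightarrow> bool" where
  "is_interval_set L \<longleftrightarrow> (\<exists>a b. a \<le> b \<and> L = {a..b})"

definition zero_sum_seqs :: "'g::{ab_group_add, finite} multiset set" where
  "zero_sum_seqs = {S. sum_mset S = 0}"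

abbreviation minimal_zero_sum_seqs :: "'g::{ab_group_add, finite} multiset set" where
  "minimal_zero_sum_seqs \<equiv> atoms_in zero_sum_seqs"

definition davenport :: "'g::{ab_group_add, finite} itself \<Rightarrow> nat" where
  "davenport _ = Max (size ` (minimal_zero_sum_seqs :: 'g multiset set))"

text \<open>
  The supremum is taken in the reals.  It is over a bounded set: a zero-sum sequence \<open>A\<close> has at most
  \<open>size A\<close> atoms in any factorization and at least \<open>size A\<close> divided by the Davenport constant.
\<close>

definition zero_sum_elasticity :: "'g::{ab_group_add, finite} itself \<Rightarrow> real" where
  "zero_sum_elasticity _ =
     (SUP A \<in> (zero_sum_seqs :: 'g multiset set) - {{#}}. elasticity (length_set zero_sum_seqs A))"

definition max_elastic_seqs :: "'g::{ab_group_add, finite} multiset set" where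
  "max_elastic_seqs = insert {#} {A \<in> zero_sum_seqs.
     elasticity (length_set zero_sum_seqs A) = zero_sum_elasticity TYPE('g)}"

end

theory Submission
  imports Defs "HOL-Library.Multiset_Order" "HOL-Computational_Algebra.Polynomial"
begin

text \<open>
  Let \<open>D\<close> be the Davenport constant of the group and \<open>H\<close> the monoid of zero-sum sequences of
  maximal elasticity.  The atoms have size at most \<open>D\<close>, and, apart from \<open>{#0#}\<close>, size at least
  \<open>2\<close>; since \<open>D \<ge> 3\<close>, the maximal elasticity is \<open>D / 2\<close>, and a sequence lies in \<open>H\<close> iff it is both
  a product of atoms of size \<open>D\<close> and a product of pairs \<open>{#g, - g#}\<close> with \<open>g \<noteq> 0\<close> (in the form of
  lengths: \<open>max_elastic_seqs_iff\<close>).  This condition is preserved by products, and by Dickson's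
  lemma \<open>H\<close> has only finitely many atoms (\<open>finite_atoms_max_elastic\<close>).

  The elements of \<open>H\<close> with a factorization of length \<open>n\<close> in \<open>H\<close> thus form the \<open>n\<close>-fold sumset of a
  finite set.  By Khovanskii's theorem (\<open>Khovanskii\<close>) the cardinality of this sumset is a
  polynomial in \<open>n\<close> for large \<open>n\<close>, and it never vanishes, so shifting \<open>n\<close> by a constant does not
  change it asymptotically.  That is the first claim.

  For the second claim it suffices to find one \<open>X\<close> in \<open>H\<close> such that \<open>X + A\<close> has an interval as its
  set of lengths for every \<open>A\<close> in \<open>H\<close>: if \<open>X\<close> has length \<open>k\<close> in \<open>H\<close>, translation by \<open>X\<close> maps the
  \<open>(n - k)\<close>-fold sumset injectively into the set in the numerator, and the first claim applies.
  Two facts produce \<open>X\<close>.  First, the lengths of any element of \<open>H\<close> run from its smallest to its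
  largest one with gaps bounded in terms of \<open>D\<close>, by an exchange argument that creates one pair
  \<open>{#g, - g#}\<close> at a time (\<open>bounded_gaps_to_pair_factorization\<close>).  Secondly, the hypothesis on
  \<open>U\<^sub>1\<close> and \<open>U\<^sub>2\<close> yields an element \<open>C\<close> of \<open>H\<close> having both \<open>min + 1\<close> and \<open>max - 1\<close> among its
  lengths (\<open>consecutive_lengths_at_both_ends\<close>).  A power of \<open>C\<close> has long runs of consecutive
  lengths at both ends, and these fill all gaps (\<open>lengths_interval_of_consecutive\<close>).
\<close>

section \<open>Dickson's lemma\<close>

text \<open>
  Every real sequence has a monotone subsequence; in the naturals a decreasing one is eventually
  constant, so it can be replaced by a nondecreasing one.
\<close>

lemma nat_monotone_subsequence:
  fixes s :: "nat \<Rightarrow> nat"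
  obtains r :: "nat \<Rightarrow> nat" where "strict_mono r" "mono (s \<circ> r)"
proof -
  obtain f where f: "strict_mono f" "monoseq (\<lambda>n. s (f n))"
    using seq_monosub by blast
  show thesis
  proof (cases "mono (s \<circ> f)")
    case True
    then show thesis using f that by blast
  next
    case False
    then have anti: "s (f n) \<le> s (f m)" if "m \<le> n" for m n
      using f(2) that by (simp add: monoseq_def mono_def comp_def) blast
    \<comment> \<open>The minimum of the subsequence is attained, and from then on a decreasing sequence is
      constant.\<close>
    define v where "v = (LEAST v. \<exists>N. s (f N) = v)"
    have "\<exists>N. s (f N) = v"
      unfolding v_def by (rule LeastI_ex) blast
    then obtain N where N: "s (f N) = v" by blast
    have "v \<le> s (f n)" for n
      unfolding v_def by (rule Least_le) blast
    then have "s (f (N + n)) = v" for n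
      using anti[of N "N + n"] N by (simp add: le_antisym)
    then have "mono (s \<circ> (\<lambda>n. f (N + n)))"
      by (simp add: mono_def)
    moreover have "strict_mono (\<lambda>n. f (N + n))"
      using f(1) by (simp add: strict_mono_def)
    ultimately show thesis using that by blast
  qed
qed

lemma simultaneous_monotone_subsequence:
  fixes F :: "nat \<Rightarrow> 'i \<Rightarrow> nat"
  assumes "finite J"
  shows "\<exists>r :: nat \<Rightarrow> nat. strict_mono r \<and> (\<forall>i\<in>J. mono (\<lambda>n. F (r n) i))"
  using assms
proof (induction J)
  case empty
  show ?case by (intro exI[of _ id]) (simp add: strict_mono_def)
next
  case (insert j J)
  then obtain r :: "nat \<Rightarrow> nat" where r: "strict_mono r" "\<forall>i\<in>J. mono (\<lambda>n. F (r n) i)"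
    by blast
  obtain q :: "nat \<Rightarrow> nat" where q: "strict_mono q" "mono ((\<lambda>n. F (r n) j) \<circ> q)"
    using nat_monotone_subsequence by blast
  have "strict_mono (r \<circ> q)" using r(1) q(1) by (simp add: strict_mono_o)
  moreover have "\<forall>i\<in>insert j J. mono (\<lambda>n. F ((r \<circ> q) n) i)"
  proof
    fix i assume "i \<in> insert j J"
    then consider "i = j" | "i \<in> J" by blast
    then show "mono (\<lambda>n. F ((r \<circ> q) n) i)"
    proof cases
      case 1
      then show ?thesis using q(2) by (simp add: comp_def)
    next
      case 2
      with r(2) have mono: "mono (\<lambda>n. F (r n) i)" by blast
      show ?thesis
        using monoD[OF mono] monoD[OF strict_mono_mono[OF q(1)]] by (simp add: monoI)
    qed
  qed
  ultimately show ?case by (intro exI[of _ "r \<circ> q"] conjI)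
qed

text \<open>
  An injective sequence in an infinite set has a subsequence along which all the finitely many
  multiplicities are nondecreasing, and its first two members are comparable.
\<close>

lemma Dickson:
  assumes "finite I" "infinite X" "\<And>M. M \<in> X \<Longrightarrow> set_mset M \<subseteq> I"
  obtains M N where "M \<in> X" "N \<in> X" "M \<noteq> N" "M \<subseteq># N"
proof -
  obtain f :: "nat \<Rightarrow> 'a multiset" where f: "inj f" "range f \<subseteq> X"
    using infinite_countable_subset[OF assms(2)] by blast
  obtain r :: "nat \<Rightarrow> nat" where r: "strict_mono r" "\<forall>i\<in>I. mono (\<lambda>n. count (f (r n)) i)"
    using simultaneous_monotone_subsequence[OF assms(1), of "\<lambda>n. count (f n)"] by blast
  have "f (r 0) \<noteq> f (r 1)"
    using f(1) strict_mono_eq[OF r(1), of 0 1] by (simp add: inj_eq)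
  moreover have "count (f (r 0)) i \<le> count (f (r 1)) i" for i
  proof (cases "i \<in> I")
    case True
    then have "mono (\<lambda>n. count (f (r n)) i)" using r(2) by blast
    then show ?thesis by (rule monoD) simp
  next
    case False
    then have "i \<notin># f (r 0)" using assms(3) f(2) by blast
    then show ?thesis by (simp add: not_in_iff)
  qed
  then have "f (r 0) \<subseteq># f (r 1)" by (simp add: subseteq_mset_def)
  ultimately show thesis using that f(2) by blast
qed

section \<open>Eventually polynomial functions\<close>

definition eventually_polynomial :: "(nat \<Rightarrow> real) \<Rightarrow> bool" where
  "eventually_polynomial f \<longleftrightarrow> (\<exists>p. \<forall>\<^sub>F n in sequentially. f n = poly p (real n))"

lemma eventually_polynomialI:
  "\<forall>\<^sub>F n in sequentially. f n = poly p (real n) \<Longrightarrow> eventually_polynomial f"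
  unfolding eventually_polynomial_def by blast

lemma eventually_polynomial_cong:
  assumes "eventually_polynomial g" "\<forall>\<^sub>F n in sequentially. f n = g n"
  shows "eventually_polynomial f"
proof -
  obtain p where "\<forall>\<^sub>F n in sequentially. g n = poly p (real n)"
    using assms(1) by (auto simp: eventually_polynomial_def)
  with assms(2) have "\<forall>\<^sub>F n in sequentially. f n = poly p (real n)"
    by eventually_elim simp
  then show ?thesis by (rule eventually_polynomialI)
qed

lemma eventually_polynomial_const: "eventually_polynomial (\<lambda>_. c)"
  by (rule eventually_polynomialI[where p = "[:c:]"]) simp

lemma eventually_polynomial_linear: "eventually_polynomial (\<lambda>n. real n + c)"
  by (rule eventually_polynomialI[where p = "[:c, 1:]"]) simp

lemma eventually_polynomial_add:
  assumes "eventually_polynomial f" "eventually_polynomial g"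
  shows "eventually_polynomial (\<lambda>n. f n + g n)"
proof -
  obtain p q where "\<forall>\<^sub>F n in sequentially. f n = poly p (real n)"
    "\<forall>\<^sub>F n in sequentially. g n = poly q (real n)"
    using assms by (auto simp: eventually_polynomial_def)
  then have "\<forall>\<^sub>F n in sequentially. f n + g n = poly (p + q) (real n)"
    by eventually_elim simp
  then show ?thesis by (rule eventually_polynomialI)
qed

lemma eventually_polynomial_mult:
  assumes "eventually_polynomial f" "eventually_polynomial g"
  shows "eventually_polynomial (\<lambda>n. f n * g n)"
proof -
  obtain p q where "\<forall>\<^sub>F n in sequentially. f n = poly p (real n)"
    "\<forall>\<^sub>F n in sequentially. g n = poly q (real n)"
    using assms by (auto simp: eventually_polynomial_def)
  then have "\<forall>\<^sub>F n in sequentially. f n * g n = poly (p * q) (real n)"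
    by eventually_elim simp
  then show ?thesis by (rule eventually_polynomialI)
qed

lemma eventually_polynomial_sum:
  assumes "finite S" "\<And>s. s \<in> S \<Longrightarrow> eventually_polynomial (f s)"
  shows "eventually_polynomial (\<lambda>n. \<Sum>s\<in>S. f s n)"
  using assms
  by (induction S) (auto intro: eventually_polynomial_const eventually_polynomial_add)

lemma eventually_polynomial_prod:
  assumes "finite S" "\<And>s. s \<in> S \<Longrightarrow> eventually_polynomial (f s)"
  shows "eventually_polynomial (\<lambda>n. \<Prod>s\<in>S. f s n)"
  using assms
  by (induction S) (auto intro: eventually_polynomial_const eventually_polynomial_mult)

lemma eventually_polynomial_diff_arg:
  assumes "eventually_polynomial f"
  shows "eventually_polynomial (\<lambda>n. f (n - k))"
proof -
  obtain p where "\<forall>\<^sub>F n in sequentially. f n = poly p (real n)"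
    using assms by (auto simp: eventually_polynomial_def)
  then obtain N where N: "\<And>n. n \<ge> N \<Longrightarrow> f n = poly p (real n)"
    by (auto simp: eventually_sequentially)
  have "\<forall>\<^sub>F n in sequentially. f (n - k) = poly (pcompose p [:- real k, 1:]) (real n)"
    using eventually_ge_at_top[of "N + k"]
    by eventually_elim (simp add: N poly_pcompose of_nat_diff)
  then show ?thesis by (rule eventually_polynomialI)
qed

text \<open>
  Numerator and denominator are both asymptotic to the leading coefficient times \<open>n ^ degree p\<close>.
\<close>

lemma poly_shift_ratio_tendsto_1:
  fixes p :: "real poly"
  assumes "p \<noteq> 0"
  shows "(\<lambda>n. poly p (real (n - k)) / poly p (real n)) \<longlonglongrightarrow> 1"
proof -
  let ?d = "degree p"
  have real_inf: "filterlim real at_infinity sequentially"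
    by (rule filterlim_real_sequentially[THEN filterlim_at_top_imp_at_infinity])
  have norm_lim: "(\<lambda>n. poly p (real n) / real n ^ ?d) \<longlonglongrightarrow> lead_coeff p"
    using filterlim_compose[OF poly_divide_tendsto_aux real_inf] .
  have "filterlim (\<lambda>n. n - k) sequentially sequentially"
    by (rule filterlim_minus_const_nat_at_top)
  then have shift_lim: "(\<lambda>n. poly p (real (n - k)) / real (n - k) ^ ?d) \<longlonglongrightarrow> lead_coeff p"
    using filterlim_compose[OF norm_lim] by blast
  have "(\<lambda>n. 1 - real k * inverse (real n)) \<longlonglongrightarrow> 1 - real k * 0"
    by (intro tendsto_intros lim_inverse_n)
  moreover have "\<forall>\<^sub>F n in sequentially. 1 - real k * inverse (real n) = real (n - k) / real n"
    using eventually_gt_at_top[of k]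
    by eventually_elim (simp add: of_nat_diff field_simps)
  ultimately have "(\<lambda>n. real (n - k) / real n) \<longlonglongrightarrow> 1 - real k * 0"
    by (rule Lim_transform_eventually)
  then have "(\<lambda>n. real (n - k) / real n) \<longlonglongrightarrow> 1"
    by simp
  then have pow_lim: "(\<lambda>n. (real (n - k) / real n) ^ ?d) \<longlonglongrightarrow> 1 ^ ?d"
    by (rule tendsto_power)
  have "(\<lambda>n. poly p (real (n - k)) / real (n - k) ^ ?d * (real (n - k) / real n) ^ ?d
      / (poly p (real n) / real n ^ ?d)) \<longlonglongrightarrow> lead_coeff p * 1 ^ ?d / lead_coeff p"
    using assms by (intro tendsto_intros shift_lim pow_lim norm_lim) auto
  moreover have "\<forall>\<^sub>F n in sequentially.
      poly p (real (n - k)) / real (n - k) ^ ?d * (real (n - k) / real n) ^ ?d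
      / (poly p (real n) / real n ^ ?d) = poly p (real (n - k)) / poly p (real n)"
    using eventually_gt_at_top[of k]
    by eventually_elim (simp add: power_divide)
  ultimately have "(\<lambda>n. poly p (real (n - k)) / poly p (real n)) \<longlonglongrightarrow>
      lead_coeff p * 1 ^ ?d / lead_coeff p"
    by (rule Lim_transform_eventually)
  then show ?thesis using assms by simp
qed

lemma eventually_polynomial_ratio:
  assumes "eventually_polynomial f" "\<And>n. f n \<noteq> 0"
  shows "(\<lambda>n. f (n - k) / f n) \<longlonglongrightarrow> 1"
proof -
  obtain p where p: "\<forall>\<^sub>F n in sequentially. f n = poly p (real n)"
    using assms(1) by (auto simp: eventually_polynomial_def)
  then obtain N where N: "\<And>n. n \<ge> N \<Longrightarrow> f n = poly p (real n)"
    by (auto simp: eventually_sequentially)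
  have "p \<noteq> 0"
    using N[of N] assms(2)[of N] by auto
  then have "(\<lambda>n. poly p (real (n - k)) / poly p (real n)) \<longlonglongrightarrow> 1"
    by (rule poly_shift_ratio_tendsto_1)
  moreover have "\<forall>\<^sub>F n in sequentially. poly p (real (n - k)) / poly p (real n) = f (n - k) / f n"
    using eventually_ge_at_top[of "N + k"]
    by eventually_elim (simp add: N)
  ultimately show ?thesis by (rule Lim_transform_eventually)
qed

section \<open>Counting multisets in an up-closed set\<close>

text \<open>
  Stars and bars: the count is a binomial coefficient whose lower index \<open>card I - 1\<close> is constant,
  hence a product of a fixed number of linear factors in \<open>n\<close>.  Without letters only the multiset
  of size \<open>0\<close> exists.
\<close>

lemma eventually_polynomial_card_multisets_of_size:
  assumes "finite I"
  shows "eventually_polynomial (\<lambda>n. real (card (multisets_of_size I n)))"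
proof (cases "I = {}")
  case True
  have "\<forall>\<^sub>F n in sequentially. real (card (multisets_of_size I n)) = 0"
    using eventually_gt_at_top[of 0] by eventually_elim (simp add: True)
  then show ?thesis
    by (rule eventually_polynomial_cong[OF eventually_polynomial_const])
next
  case False
  then obtain a where a: "card I = Suc a"
    using assms by (metis card_0_eq not0_implies_Suc)
  have "real (card (multisets_of_size I n)) = (\<Prod>i<a. real n + (1 + real i)) * (1 / fact a)" for n
  proof -
    have "card (multisets_of_size I n) = (n + a) choose a"
      using card_multisets_of_size[OF assms, of n] a binomial_symmetric[of n "n + a"]
      by (simp add: add.commute)
    then have "real (card (multisets_of_size I n)) = real (n + a) gchoose a"
      by (simp add: binomial_gbinomial)
    also have "\<dots> = pochhammer (real n + 1) a / fact a"
      by (simp add: gbinomial_pochhammer')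
    also have "pochhammer (real n + 1) a = (\<Prod>i<a. real n + (1 + real i))"
      by (simp add: pochhammer_prod atLeast0LessThan add.assoc)
    finally show ?thesis by simp
  qed
  moreover have "eventually_polynomial (\<lambda>n. (\<Prod>i<a. real n + (1 + real i)) * (1 / fact a))"
    by (intro eventually_polynomial_mult eventually_polynomial_prod
        eventually_polynomial_linear eventually_polynomial_const finite_lessThan)
  ultimately show ?thesis by (simp only:)
qed

text \<open>
  Removing \<open>C\<close> identifies the multisets above \<open>C\<close> of size \<open>n\<close> with all multisets of size
  \<open>n - size C\<close>.
\<close>

lemma eventually_polynomial_card_cone:
  assumes "finite I" "set_mset C \<subseteq> I"
  shows "eventually_polynomial (\<lambda>n. real (card {M \<in> multisets_of_size I n. C \<subseteq># M}))"
proof -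
  have "\<forall>\<^sub>F n in sequentially. real (card {M \<in> multisets_of_size I n. C \<subseteq># M}) =
      real (card (multisets_of_size I (n - size C)))"
    using eventually_ge_at_top[of "size C"]
  proof eventually_elim
    case (elim n)
    have bij: "bij_betw ((+) C) (multisets_of_size I (n - size C)) {M \<in> multisets_of_size I n. C \<subseteq># M}"
      using assms elim
      by (intro bij_betw_byWitness[where f' = "\<lambda>M. M - C"] ballI subsetI)
        (auto simp: multisets_of_size_def size_Diff_submset dest!: in_diffD)
    show ?case using bij_betw_same_card[OF bij] by simp
  qed
  with eventually_polynomial_diff_arg[OF eventually_polynomial_card_multisets_of_size[OF assms(1)]]
  show ?thesis by (rule eventually_polynomial_cong)
qed

text \<open>
  The apex \<open>L\<close> is the join of the members of \<open>B\<close>; it does not depend on \<open>n\<close>, which is what makes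
  every term of the inclusion-exclusion formula below eventually polynomial.
\<close>

lemma Inter_cones_eq_cone:
  assumes "finite B" "B \<noteq> {}" "\<And>C. C \<in> B \<Longrightarrow> set_mset C \<subseteq> I"
  shows "\<exists>L. set_mset L \<subseteq> I \<and>
    (\<forall>n. (\<Inter>C\<in>B. {M \<in> multisets_of_size I n. C \<subseteq># M}) = {M \<in> multisets_of_size I n. L \<subseteq># M})"
  using assms
proof (induction B rule: finite_ne_induct)
  case (singleton C)
  then show ?case by auto
next
  case (insert C B)
  have "\<exists>L. set_mset L \<subseteq> I \<and>
    (\<forall>n. (\<Inter>C\<in>B. {M \<in> multisets_of_size I n. C \<subseteq># M}) = {M \<in> multisets_of_size I n. L \<subseteq># M})"
    by (rule insert.IH) (simp add: insert.prems)
  then obtain L where L: "set_mset L \<subseteq> I"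
    "\<forall>n. (\<Inter>C\<in>B. {M \<in> multisets_of_size I n. C \<subseteq># M}) = {M \<in> multisets_of_size I n. L \<subseteq># M}"
    by (elim exE conjE) (rule that)
  have "set_mset (C \<union># L) \<subseteq> I"
    using L(1) insert.prems[of C] by simp
  moreover have "(\<Inter>C\<in>insert C B. {M \<in> multisets_of_size I n. C \<subseteq># M}) =
      {M \<in> multisets_of_size I n. C \<union># L \<subseteq># M}" for n
    unfolding INT_insert L(2)[rule_format] by (simp add: Collect_conj_eq[symmetric]) auto
  ultimately show ?case by blast
qed

text \<open>
  By Dickson's lemma an up-closed set has finitely many minimal elements, so it is a finite union
  of cones; inclusion-exclusion reduces the count to single cones.
\<close>

lemma eventually_polynomial_card_up_set:
  assumes "finite I" and up: "\<And>M N. M \<in> U \<Longrightarrow> M \<subseteq># N \<Longrightarrow> set_mset N \<subseteq> I \<Longrightarrow> N \<in> U"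
    and U: "\<And>M. M \<in> U \<Longrightarrow> set_mset M \<subseteq> I"
  shows "eventually_polynomial (\<lambda>n. real (card {M \<in> multisets_of_size I n. M \<in> U}))"
proof -
  \<comment> \<open>The minimal elements of the up-closed set, the apices of the cones that cover it.\<close>
  define K where "K = {M \<in> U. \<forall>N\<in>U. N \<subseteq># M \<longrightarrow> N = M}"
  let ?cone = "\<lambda>n C. {M \<in> multisets_of_size I n. C \<subseteq># M}"
  have "finite K"
  proof (rule ccontr)
    assume "infinite K"
    then obtain M N where "M \<in> K" "N \<in> K" "M \<noteq> N" "M \<subseteq># N"
      using Dickson[OF assms(1), of K] U by (auto simp: K_def)
    then show False by (auto simp: K_def)
  qed
  have min: "\<exists>C\<in>K. C \<subseteq># M" if "M \<in> U" for M
    using that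
  proof (induction "size M" arbitrary: M rule: less_induct)
    case less
    show ?case
    proof (cases "M \<in> K")
      case False
      then obtain N where "N \<in> U" "N \<subset># M"
        using less.prems by (auto simp: K_def subset_mset.less_le)
      then show ?thesis
        using less.hyps[of N] mset_subset_size[of N M] by (meson subset_mset.less_imp_le subset_mset.trans)
    qed auto
  qed
  have U_cones: "{M \<in> multisets_of_size I n. M \<in> U} = \<Union> (?cone n ` K)" for n
  proof (intro equalityI subsetI)
    fix M assume "M \<in> \<Union> (?cone n ` K)"
    then obtain C where "C \<in> U" "C \<subseteq># M" "M \<in> multisets_of_size I n"
      by (auto simp: K_def)
    then show "M \<in> {M \<in> multisets_of_size I n. M \<in> U}"
      using up[of C M] by (simp add: multisets_of_size_def)
  next
    fix M assume "M \<in> {M \<in> multisets_of_size I n. M \<in> U}"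
    then show "M \<in> \<Union> (?cone n ` K)"
      using min[of M] by blast
  qed
  have incl_excl: "real (card {M \<in> multisets_of_size I n. M \<in> U}) =
      (\<Sum>B | B \<subseteq> K \<and> B \<noteq> {}. (- 1) ^ (card B + 1) * real (card (\<Inter> (?cone n ` B))))" for n
  proof -
    interpret Incl_Excl finite "\<lambda>S. real (card S) :: real"
      by unfold_locales (auto simp: card_Un_disjnt)
    show ?thesis
      unfolding U_cones using \<open>finite K\<close> finite_multisets_of_size[OF assms(1), of n]
      by (intro restricted_indexed) auto
  qed
  have "eventually_polynomial (\<lambda>n. (- 1) ^ (card B + 1) * real (card (\<Inter> (?cone n ` B))))"
    if B: "B \<in> {B. B \<subseteq> K \<and> B \<noteq> {}}" for B
  proof -
    have "finite B" "B \<noteq> {}" "\<And>C. C \<in> B \<Longrightarrow> set_mset C \<subseteq> I"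
      using B \<open>finite K\<close> U finite_subset by (auto simp: K_def)
    from Inter_cones_eq_cone[OF this] obtain L where "set_mset L \<subseteq> I" "\<And>n. \<Inter> (?cone n ` B) = ?cone n L"
      by blast
    then show ?thesis
      using eventually_polynomial_card_cone[OF assms(1)]
      by (simp add: eventually_polynomial_mult eventually_polynomial_const del: power_Suc)
  qed
  then show ?thesis
    unfolding incl_excl using \<open>finite K\<close> by (intro eventually_polynomial_sum) auto
qed

section \<open>The growth of iterated sumsets\<close>

text \<open>
  The \<open>n\<close>-fold sumset \<open>A + \<dots> + A\<close>, formed with repetitions.
\<close>

definition fold_sums :: "'m::comm_monoid_add set \<Rightarrow> nat \<Rightarrow> 'm set" where
  "fold_sums A n = {sum_list us | us. set us \<subseteq> A \<and> length us = n}"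

lemma fold_sums_eq_image_multisets_of_size:
  assumes "bij_betw h I A"
  shows "fold_sums A n = (\<lambda>M. \<Sum>i\<in>#M. h i) ` multisets_of_size I n"
proof (intro equalityI subsetI)
  fix x assume "x \<in> fold_sums A n"
  then obtain us where us: "x = sum_list us" "set us \<subseteq> A" "length us = n"
    by (auto simp: fold_sums_def)
  let ?M = "image_mset (inv_into I h) (mset us)"
  have "set_mset ?M \<subseteq> I"
    using us(2) bij_betw_inv_into[OF assms] by (auto simp: bij_betw_def)
  moreover have "image_mset h ?M = mset us"
    using us(2) assms
    by (simp add: multiset.map_comp comp_def)
       (rule multiset.map_ident_strong, metis bij_betw_inv_into_right set_mset_mset subsetD)
  ultimately show "x \<in> (\<lambda>M. \<Sum>i\<in>#M. h i) ` multisets_of_size I n"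
    using us by (intro image_eqI[of _ _ ?M]) (auto simp: multisets_of_size_def sum_mset_sum_list)
next
  fix x assume "x \<in> (\<lambda>M. \<Sum>i\<in>#M. h i) ` multisets_of_size I n"
  then obtain M where M: "x = (\<Sum>i\<in>#M. h i)" "set_mset M \<subseteq> I" "size M = n"
    by (auto simp: multisets_of_size_def)
  obtain xs where xs: "M = mset xs" by (metis ex_mset)
  have "x = sum_list (map h xs)" "set (map h xs) \<subseteq> A" "length (map h xs) = n"
    using M xs assms by (auto simp: sum_mset_sum_list bij_betw_def simp flip: mset_map)
  then show "x \<in> fold_sums A n" unfolding fold_sums_def by blast
qed

text \<open>
  Khovanskii's theorem, by the argument of Nathanson and Ruzsa.  Index the elements of \<open>A\<close> by an
  initial segment of the naturals; a sum of \<open>n\<close> elements is then given by a multiset of \<open>n\<close>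
  indices, in general by several.  Choose the least one in the multiset order.  The multisets that
  are not chosen form an up-closed set: if \<open>M\<close> can be replaced by a smaller multiset with equal
  size and sum, then so can \<open>M + T\<close>, because the order is translation invariant.  Hence the number
  of chosen multisets of size \<open>n\<close>, which is the size of the sumset, is a difference of two
  eventually polynomial counts.
\<close>

theorem Khovanskii:
  fixes A :: "'m::comm_monoid_add set"
  assumes "finite A"
  shows "eventually_polynomial (\<lambda>n. real (card (fold_sums A n)))"
proof -
  obtain h where h: "bij_betw h {..<card A} A"
    using ex_bij_betw_nat_finite[OF assms] by (auto simp: atLeast0LessThan)
  let ?I = "{..<card A}"
  define \<phi> where "\<phi> = (\<lambda>M. \<Sum>i\<in>#M. h i)"
  have \<phi>_add: "\<phi> (M + N) = \<phi> M + \<phi> N" for M N by (simp add: \<phi>_def)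
  \<comment> \<open>The multisets that are not least among those with the same size and sum.\<close>
  define U where "U = {M. set_mset M \<subseteq> ?I \<and>
    (\<exists>N<M. set_mset N \<subseteq> ?I \<and> size N = size M \<and> \<phi> N = \<phi> M)}"
  have up: "N \<in> U" if "M \<in> U" "M \<subseteq># N" "set_mset N \<subseteq> ?I" for M N
  proof -
    obtain M' where M': "M' < M" "set_mset M' \<subseteq> ?I" "size M' = size M" "\<phi> M' = \<phi> M"
      using \<open>M \<in> U\<close> by (auto simp: U_def)
    obtain T where T: "N = M + T" using \<open>M \<subseteq># N\<close> by (metis mset_subset_eq_exists_conv)
    have "M' + T < N" using M'(1) T by (simp add: union_le_mono1)
    then show ?thesis
      using M' T that(3) unfolding U_def by (auto simp: \<phi>_add intro!: exI[of _ "M' + T"])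
  qed
  let ?R = "\<lambda>n. multisets_of_size ?I n - {M \<in> multisets_of_size ?I n. M \<in> U}"
  have "bij_betw \<phi> (?R n) (fold_sums A n)" for n
  proof (rule bij_betw_imageI)
    show "inj_on \<phi> (?R n)"
    proof (rule inj_onI)
      fix M N assume "M \<in> ?R n" "N \<in> ?R n" "\<phi> M = \<phi> N"
      then have "\<not> M < N" "\<not> N < M"
        by (auto simp: multisets_of_size_def U_def)
      then show "M = N" by simp
    qed
    show "\<phi> ` ?R n = fold_sums A n"
      unfolding fold_sums_eq_image_multisets_of_size[OF h] \<phi>_def[symmetric]
    proof (intro equalityI subsetI)
      fix x assume "x \<in> \<phi> ` multisets_of_size ?I n"
      then have ex: "\<exists>M. M \<in> multisets_of_size ?I n \<and> \<phi> M = x" by blast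
      define M where "M = (LEAST M. M \<in> multisets_of_size ?I n \<and> \<phi> M = x)"
      have M: "M \<in> multisets_of_size ?I n \<and> \<phi> M = x"
        unfolding M_def by (rule LeastI_ex[OF ex])
      have "M \<notin> U"
      proof
        assume "M \<in> U"
        then obtain N where "N < M" "N \<in> multisets_of_size ?I n \<and> \<phi> N = x"
          using M by (auto simp: U_def multisets_of_size_def)
        then show False unfolding M_def using not_less_Least by blast
      qed
      with M show "x \<in> \<phi> ` ?R n" by blast
    qed blast
  qed
  then have "card (fold_sums A n) = card (?R n)" for n
    using bij_betw_same_card by (metis (no_types, lifting))
  moreover have "real (card (?R n)) = real (card (multisets_of_size ?I n)) +
      - 1 * real (card {M \<in> multisets_of_size ?I n. M \<in> U})" for n
    using finite_multisets_of_size[of ?I n]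
    by (subst card_Diff_subset) (auto simp: of_nat_diff card_mono)
  moreover have "eventually_polynomial (\<lambda>n. real (card (multisets_of_size ?I n)) +
      - 1 * real (card {M \<in> multisets_of_size ?I n. M \<in> U}))"
    by (intro eventually_polynomial_add eventually_polynomial_mult eventually_polynomial_const
        eventually_polynomial_card_multisets_of_size eventually_polynomial_card_up_set)
       (simp_all add: up, simp add: U_def)
  ultimately show ?thesis by simp
qed

section \<open>Factorizations in monoids of multisets\<close>

lemma units_in_multiset_monoid:
  assumes "{#} \<in> B"
  shows "units_in B = {{#} :: 'a multiset}"
  using assms by (auto simp: units_in_def)

lemma atoms_in_multiset_monoid_iff:
  assumes "{#} \<in> B"
  shows "u \<in> atoms_in B \<longleftrightarrow>
    u \<in> B \<and> u \<noteq> ({#} :: 'a multiset) \<and> (\<forall>x\<in>B. \<forall>y\<in>B. u = x + y \<longrightarrow> x = {#} \<or> y = {#})"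
  using assms by (simp add: atoms_in_def units_in_multiset_monoid)

text \<open>
  A nonempty element of \<open>B\<close> which is not an atom splits into two strictly smaller elements of \<open>B\<close>.
\<close>

lemma ex_factorization:
  fixes A :: "'a multiset"
  assumes "{#} \<in> B" "A \<in> B"
  obtains z where "set_mset z \<subseteq> atoms_in B" "sum_mset z = A"
proof -
  have "\<exists>z. set_mset z \<subseteq> atoms_in B \<and> sum_mset z = A"
    using assms(2)
  proof (induction "size A" arbitrary: A rule: less_induct)
    case less
    consider "A = {#}" | "A \<in> atoms_in B" | x y where "x \<in> B" "y \<in> B" "A = x + y" "x \<noteq> {#}" "y \<noteq> {#}"
      using less.prems atoms_in_multiset_monoid_iff[OF assms(1), of A] by blast
    then show ?case
    proof cases
      case 1
      then show ?thesis by (intro exI[of _ "{#}"]) simp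
    next
      case 2
      then show ?thesis by (intro exI[of _ "{#A#}"]) simp
    next
      case 3
      then have "size x < size A" "size y < size A"
        by (auto simp: nonempty_has_size)
      with less.hyps 3 obtain zx zy where
        "set_mset zx \<subseteq> atoms_in B" "sum_mset zx = x" "set_mset zy \<subseteq> atoms_in B" "sum_mset zy = y"
        by meson
      then show ?thesis using 3 by (intro exI[of _ "zx + zy"]) simp
    qed
  qed
  then show thesis using that by blast
qed

lemma in_length_set_iff_list:
  fixes A :: "'a multiset"
  assumes "{#} \<in> B"
  shows "k \<in> length_set B A \<longleftrightarrow> (\<exists>us. set us \<subseteq> atoms_in B \<and> length us = k \<and> sum_list us = A)"
proof (cases "A = {#}")
  case True
  have "us = []" if "set us \<subseteq> atoms_in B" "sum_list us = {#}" for us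
    using that atoms_in_multiset_monoid_iff[OF assms] by (cases us) auto
  then show ?thesis
    using True by (auto simp: length_set_def units_in_multiset_monoid[OF assms])
next
  case False
  then show ?thesis by (simp add: length_set_def units_in_multiset_monoid[OF assms])
qed

lemma in_length_set_iff:
  fixes A :: "'a multiset"
  assumes "{#} \<in> B"
  shows "k \<in> length_set B A \<longleftrightarrow> (\<exists>z. set_mset z \<subseteq> atoms_in B \<and> size z = k \<and> sum_mset z = A)"
  unfolding in_length_set_iff_list[OF assms]
  by (metis ex_mset set_mset_mset size_mset sum_mset_sum_list)

lemma zero_in_length_set_empty:
  assumes "{#} \<in> B"
  shows "0 \<in> length_set B {#}"
  unfolding in_length_set_iff[OF assms] by (intro exI[of _ "{#}"]) simp

lemma atom_one_in_length_set:
  assumes "{#} \<in> B" "U \<in> atoms_in B"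
  shows "1 \<in> length_set B (U :: 'a multiset)"
  unfolding in_length_set_iff[OF assms(1)] using assms(2) by (intro exI[of _ "{#U#}"]) simp

lemma length_set_add:
  assumes "{#} \<in> B" "j \<in> length_set B X" "k \<in> length_set B (Y :: 'a multiset)"
  shows "j + k \<in> length_set B (X + Y)"
proof -
  obtain x y where "set_mset x \<subseteq> atoms_in B" "size x = j" "sum_mset x = X"
    "set_mset y \<subseteq> atoms_in B" "size y = k" "sum_mset y = Y"
    using assms(2,3) unfolding in_length_set_iff[OF assms(1)] by blast
  then show ?thesis
    unfolding in_length_set_iff[OF assms(1)] by (intro exI[of _ "x + y"]) simp
qed

text \<open>
  In each of the \<open>n\<close> copies of \<open>A\<close> one may choose between a factorization of length \<open>a\<close> and one of
  length \<open>a + 1\<close>, so a power of \<open>A\<close> has a long run of consecutive lengths.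
\<close>

lemma length_set_repeat_consecutive:
  fixes A :: "'a multiset"
  assumes B: "{#} \<in> B" and a: "a \<in> length_set B A" "a + 1 \<in> length_set B A"
    and t: "n * a \<le> t" "t \<le> n * a + n"
  shows "t \<in> length_set B (repeat_mset n A)"
  using t
proof (induction n arbitrary: t)
  case 0
  then show ?case using zero_in_length_set_empty[OF B] by simp
next
  case (Suc n)
  show ?case
  proof (cases "t \<le> n * a + n + a")
    case True
    then have "t - a \<in> length_set B (repeat_mset n A)"
      using Suc by simp
    from length_set_add[OF B a(1) this] show ?thesis
      using Suc.prems by simp
  next
    case False
    then have "t - (a + 1) \<in> length_set B (repeat_mset n A)"
      using Suc by simp
    from length_set_add[OF B a(2) this] show ?thesis
      using False by simp
  qed
qed

lemma length_set_le_size: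
  assumes "{#} \<in> B" "k \<in> length_set B (A :: 'a multiset)"
  shows "k \<le> size A"
proof -
  obtain z where z: "set_mset z \<subseteq> atoms_in B" "size z = k" "sum_mset z = A"
    using assms(2) unfolding in_length_set_iff[OF assms(1)] by blast
  from z(1) have "size z \<le> size (sum_mset z)"
  proof (induction z)
    case (add u z)
    then have "u \<noteq> {#}" using atoms_in_multiset_monoid_iff[OF assms(1)] by auto
    then show ?case using add by (cases u) auto
  qed simp
  with z show ?thesis by simp
qed

lemma finite_length_set:
  assumes "{#} \<in> B"
  shows "finite (length_set B (A :: 'a multiset))"
  using length_set_le_size[OF assms] by (meson finite_nat_set_iff_bounded_le)

lemma length_set_nonempty:
  assumes "{#} \<in> B" "A \<in> B"
  shows "length_set B (A :: 'a multiset) \<noteq> {}"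
  using ex_factorization[OF assms] in_length_set_iff[OF assms(1)] by (metis empty_iff)

section \<open>Minimal zero-sum sequences\<close>

abbreviation lengths :: "'g::{ab_group_add, finite} multiset \<Rightarrow> nat set" where
  "lengths \<equiv> length_set zero_sum_seqs"

lemma empty_in_zero_sum_seqs [simp]: "{#} \<in> zero_sum_seqs"
  by (simp add: zero_sum_seqs_def)

lemma zero_sum_seqs_add: "A \<in> zero_sum_seqs \<Longrightarrow> B \<in> zero_sum_seqs \<Longrightarrow> A + B \<in> zero_sum_seqs"
  by (simp add: zero_sum_seqs_def)

lemma zero_sum_seqs_cancel: "A + B \<in> zero_sum_seqs \<Longrightarrow> A \<in> zero_sum_seqs \<Longrightarrow> B \<in> zero_sum_seqs"
  by (simp add: zero_sum_seqs_def)

lemmas in_lengths_iff = in_length_set_iff[OF empty_in_zero_sum_seqs]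
lemmas lengths_add = length_set_add[OF empty_in_zero_sum_seqs]

lemma minimal_zero_sum_iff:
  "U \<in> minimal_zero_sum_seqs \<longleftrightarrow>
    sum_mset U = 0 \<and> U \<noteq> {#} \<and> (\<forall>T. T \<subseteq># U \<longrightarrow> sum_mset T = 0 \<longrightarrow> T = {#} \<or> T = U)"
  (is "?L \<longleftrightarrow> ?R")
proof
  assume L: ?L
  then have U: "sum_mset U = 0" "U \<noteq> {#}"
    by (auto simp: atoms_in_multiset_monoid_iff zero_sum_seqs_def)
  moreover have "T = {#} \<or> T = U" if T: "T \<subseteq># U" "sum_mset T = 0" for T
  proof -
    obtain W where W: "U = T + W" using T(1) by (metis mset_subset_eq_exists_conv)
    then have "sum_mset W = 0" using U(1) T(2) by simp
    then have "T = {#} \<or> W = {#}"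
      using L T(2) W by (auto simp: atoms_in_multiset_monoid_iff zero_sum_seqs_def)
    then show ?thesis using W by auto
  qed
  ultimately show ?R by blast
next
  assume R: ?R
  have "x = {#} \<or> y = {#}" if "x \<in> zero_sum_seqs" "y \<in> zero_sum_seqs" "U = x + y" for x y
  proof -
    have "x \<subseteq># U" "sum_mset x = 0" using that by (simp_all add: zero_sum_seqs_def)
    then have "x = {#} \<or> x = U" using R by blast
    then show ?thesis using that(3) by auto
  qed
  then show ?L
    using R by (auto simp: atoms_in_multiset_monoid_iff zero_sum_seqs_def)
qed

lemma minimal_zero_sum_in_zero_sum: "U \<in> minimal_zero_sum_seqs \<Longrightarrow> U \<in> zero_sum_seqs"
  by (simp add: atoms_in_def)

text \<open>
  The atoms form an antichain for divisibility in the ambient free monoid.  This gives their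
  finiteness by Dickson's lemma, so that the Davenport constant is an actual maximum.
\<close>

lemma minimal_zero_sum_subset_eq:
  assumes "U \<in> minimal_zero_sum_seqs" "V \<in> minimal_zero_sum_seqs" "U \<subseteq># V"
  shows "U = V"
  using assms minimal_zero_sum_iff[of U] minimal_zero_sum_iff[of V] by blast

lemma minimal_zero_sum_zero:
  assumes "U \<in> minimal_zero_sum_seqs" "0 \<in># U"
  shows "U = {#0#}"
  using assms minimal_zero_sum_iff[of U] by (metis add_mset_not_empty mset_subset_eq_single sum_mset.singleton)

lemma minimal_zero_sum_size_ge_2:
  assumes "U \<in> minimal_zero_sum_seqs" "0 \<notin># U"
  shows "2 \<le> size U"
proof (rule ccontr)
  assume "\<not> 2 \<le> size U"
  then have "size U = 0 \<or> size U = 1" by linarith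
  then show False
  proof
    assume "size U = 1"
    then obtain g where "U = {#g#}" by (metis size_1_singleton_mset)
    then show False using assms minimal_zero_sum_iff[of U] by auto
  qed (use assms minimal_zero_sum_iff[of U] in auto)
qed

text \<open>
  One of the two factors in a proper splitting would consist of a single group element, which
  would have to be \<open>0\<close>.
\<close>

lemma small_zero_sum_is_minimal:
  assumes "sum_mset U = 0" "0 \<notin># U" "U \<noteq> {#}" "size U \<le> 3"
  shows "U \<in> minimal_zero_sum_seqs"
proof -
  have size: "2 \<le> size x" if "x \<subseteq># U" "sum_mset x = 0" "x \<noteq> {#}" for x
  proof (rule ccontr)
    assume "\<not> 2 \<le> size x"
    moreover have "size x \<noteq> 0" using that(3) by simp
    ultimately have "size x = 1" by linarith
    then obtain g where "x = {#g#}" by (metis size_1_singleton_mset)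
    then show False using that assms(2) by auto
  qed
  have "T = {#} \<or> T = U" if T: "T \<subseteq># U" "sum_mset T = 0" for T
  proof (rule ccontr)
    assume contra: "\<not> (T = {#} \<or> T = U)"
    obtain W where W: "U = T + W" using T(1) by (metis mset_subset_eq_exists_conv)
    then have "sum_mset W = 0" "W \<noteq> {#}" using assms(1) T(2) contra by auto
    then have "2 \<le> size W" using size W by simp
    moreover have "2 \<le> size T" using size T contra by blast
    ultimately show False using W assms(4) by simp
  qed
  then show ?thesis using assms minimal_zero_sum_iff by blast
qed

lemma finite_minimal_zero_sum_seqs:
  "finite (minimal_zero_sum_seqs :: 'g::{ab_group_add, finite} multiset set)"
proof (rule ccontr)
  assume "infinite (minimal_zero_sum_seqs :: 'g multiset set)"
  then obtain U V :: "'g multiset" where "U \<in> minimal_zero_sum_seqs" "V \<in> minimal_zero_sum_seqs" "U \<noteq> V" "U \<subseteq># V"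
    using Dickson[of UNIV "minimal_zero_sum_seqs :: 'g multiset set"] by auto
  then show False using minimal_zero_sum_subset_eq by blast
qed

lemma size_le_davenport:
  "U \<in> minimal_zero_sum_seqs \<Longrightarrow> size U \<le> davenport TYPE('g)"
  for U :: "'g::{ab_group_add, finite} multiset"
  unfolding davenport_def by (intro Max_ge) (auto intro: finite_minimal_zero_sum_seqs)

lemma ex_minimal_zero_sum_size_davenport:
  obtains U :: "'g::{ab_group_add, finite} multiset"
  where "U \<in> minimal_zero_sum_seqs" "size U = davenport TYPE('g)"
proof -
  have "T = {#} \<or> T = {#0#}" if "T \<subseteq># {#0#}" for T :: "'g multiset"
    using that mset_subset_size[of T "{#0#}"] by (auto simp: subset_mset.le_less)
  then have "{#0 :: 'g#} \<in> minimal_zero_sum_seqs"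
    by (simp add: minimal_zero_sum_iff)
  then have "davenport TYPE('g) \<in> size ` (minimal_zero_sum_seqs :: 'g multiset set)"
    unfolding davenport_def by (intro Max_in) (auto intro: finite_minimal_zero_sum_seqs)
  then show thesis using that by auto
qed

text \<open>
  For \<open>g \<noteq> 0\<close> and \<open>h \<noteq> 0, - g\<close> the sequence of \<open>g\<close>, \<open>h\<close>, \<open>- (g + h)\<close> is an atom.
\<close>

lemma davenport_ge_3:
  assumes "CARD('g::{ab_group_add, finite}) \<ge> 3"
  shows "davenport TYPE('g) \<ge> 3"
proof -
  have ex: "\<exists>h. h \<notin> S" if "card S < CARD('g)" for S :: "'g set"
    using that by (metis UNIV_eq_I less_irrefl)
  obtain g :: 'g where g: "g \<notin> {0}" using ex[of "{0}"] assms by auto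
  obtain h where h: "h \<notin> {0, - g}"
    using ex[of "{0, - g}"] assms card_insert_le_m1[of 2 "{- g}" 0] by auto
  have "{#g, h, - (g + h)#} \<in> minimal_zero_sum_seqs"
  proof (rule small_zero_sum_is_minimal)
    have "g + h \<noteq> 0" using h by (auto simp: add_eq_0_iff)
    then show "0 \<notin># {#g, h, - (g + h)#}" using g h by auto
  qed (simp_all add: algebra_simps)
  from size_le_davenport[OF this] show ?thesis by simp
qed

lemma sum_mset_image_uminus: "sum_mset (image_mset uminus T) = - sum_mset T"
  for T :: "'g::ab_group_add multiset"
  by (induction T) auto

lemma minimal_zero_sum_uminus:
  assumes "U \<in> minimal_zero_sum_seqs"
  shows "image_mset uminus U \<in> minimal_zero_sum_seqs"
proof -
  have "T = {#} \<or> T = image_mset uminus U" if T: "T \<subseteq># image_mset uminus U" "sum_mset T = 0" for T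
  proof -
    have "image_mset uminus T \<subseteq># image_mset uminus (image_mset uminus U)"
      using T(1) by (rule image_mset_subseteq_mono)
    then have "image_mset uminus T \<subseteq># U" by (simp add: multiset.map_comp comp_def)
    moreover have "sum_mset (image_mset uminus T) = 0" using T(2) by (simp add: sum_mset_image_uminus)
    ultimately have "image_mset uminus T = {#} \<or> image_mset uminus T = U"
      using assms minimal_zero_sum_iff by blast
    moreover have "image_mset uminus (image_mset uminus T) = T" by (simp add: multiset.map_comp comp_def)
    ultimately show ?thesis by auto
  qed
  then show ?thesis
    using assms minimal_zero_sum_iff[of U] by (simp add: minimal_zero_sum_iff sum_mset_image_uminus)
qed

lemma pair_minimal_zero_sum:
  "g \<noteq> 0 \<Longrightarrow> {#g, - g#} \<in> minimal_zero_sum_seqs"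
  by (intro small_zero_sum_is_minimal) auto

lemma size_in_lengths_symmetric:
  assumes "0 \<notin># T"
  shows "size T \<in> lengths (T + image_mset uminus T)"
  using assms
proof (induction T)
  case empty
  then show ?case by (simp add: zero_in_length_set_empty)
next
  case (add g T)
  then have "{#g, - g#} \<in> minimal_zero_sum_seqs" by (intro pair_minimal_zero_sum) auto
  from lengths_add[OF atom_one_in_length_set[OF _ this]] add
  show ?case by (simp add: add.commute add_mset_commute)
qed

section \<open>The sequences of maximal elasticity\<close>

text \<open>
  The two weighted bounds: the only atom containing \<open>0\<close> is \<open>{#0#}\<close>, and every other atom has size
  between \<open>2\<close> and the Davenport constant.  The weight given to \<open>0\<close> makes \<open>{#0#}\<close> meet the same
  bound: it counts \<open>2\<close> here, and \<open>D\<close> in the lower bound.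
\<close>

lemma lengths_upper_weighted:
  assumes "k \<in> lengths A"
  shows "2 * k \<le> size A + count A 0"
proof -
  obtain z where z: "set_mset z \<subseteq> minimal_zero_sum_seqs" "size z = k" "sum_mset z = A"
    using assms by (auto simp: in_lengths_iff)
  from z(1) have "2 * size z \<le> size (sum_mset z) + count (sum_mset z) 0"
  proof (induction z)
    case (add u z)
    have "2 \<le> size u + count u 0"
    proof (cases "0 \<in># u")
      case True
      then have "u = {#0#}" using add.prems minimal_zero_sum_zero by auto
      then show ?thesis by simp
    next
      case False
      then show ?thesis using add.prems minimal_zero_sum_size_ge_2[of u] by simp
    qed
    with add show ?case by simp
  qed simp
  with z show ?thesis by simp
qed

lemma lengths_lower_weighted:
  fixes A :: "'g::{ab_group_add, finite} multiset"
  assumes "k \<in> lengths A" and "davenport TYPE('g) \<ge> 1"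
  shows "size A + (davenport TYPE('g) - 1) * count A 0 \<le> davenport TYPE('g) * k"
proof -
  let ?D = "davenport TYPE('g)"
  obtain z where z: "set_mset z \<subseteq> minimal_zero_sum_seqs" "size z = k" "sum_mset z = A"
    using assms(1) by (auto simp: in_lengths_iff)
  from z(1) have "size (sum_mset z) + (?D - 1) * count (sum_mset z) 0 \<le> ?D * size z"
  proof (induction z)
    case (add u z)
    have "size u + (?D - 1) * count u 0 \<le> ?D"
    proof (cases "0 \<in># u")
      case True
      then have "u = {#0#}" using add.prems minimal_zero_sum_zero by auto
      then show ?thesis using assms(2) by simp
    next
      case False
      then have "count u 0 = 0" by (simp add: not_in_iff)
      then show ?thesis using add.prems size_le_davenport[of u] by simp
    qed
    moreover have "size (sum_mset z) + (?D - 1) * count (sum_mset z) 0 \<le> ?D * size z"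
      using add by simp
    ultimately show ?case by (simp add: add_mult_distrib2)
  qed simp
  with z show ?thesis by simp
qed

text \<open>
  For a sequence of size \<open>s\<close> containing \<open>0\<close> exactly \<open>m\<close> times the weighted bounds give
  \<open>2 Max \<le> s + m \<le> s + (D - 1) m \<le> D Min\<close>.  Equality throughout forces \<open>m = 0\<close>, as \<open>D \<ge> 3\<close>; then
  the longest factorizations use only atoms of size \<open>2\<close> and the shortest only atoms of size \<open>D\<close>.
\<close>

lemma elasticity_lengths_le:
  fixes A :: "'g::{ab_group_add, finite} multiset"
  assumes D: "davenport TYPE('g) \<ge> 3" and A: "A \<in> zero_sum_seqs" "A \<noteq> {#}"
  shows "elasticity (lengths A) \<le> real (davenport TYPE('g)) / 2"
    and "elasticity (lengths A) = real (davenport TYPE('g)) / 2 \<longleftrightarrow>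
      (\<exists>k\<in>lengths A. 2 * k = size A) \<and> (\<exists>k\<in>lengths A. davenport TYPE('g) * k = size A)"
proof -
  let ?D = "davenport TYPE('g)"
  let ?M = "Max (lengths A)" and ?m = "Min (lengths A)"
  have fin: "finite (lengths A)" by (simp add: finite_length_set)
  have ne: "lengths A \<noteq> {}" using A(1) by (simp add: length_set_nonempty)
  have M: "?M \<in> lengths A" and m: "?m \<in> lengths A"
    using fin ne by simp_all
  \<comment> \<open>This form avoids truncated subtraction in the weight \<open>D - 1 = c + 2\<close>.\<close>
  obtain c where c: "?D = c + 3" using D by (metis add.commute le_Suc_ex)
  have up: "2 * k \<le> size A + count A 0" if "k \<in> lengths A" for k
    using lengths_upper_weighted[OF that] .
  have low: "size A + (c + 2) * count A 0 \<le> ?D * k" if "k \<in> lengths A" for k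
    using lengths_lower_weighted[OF that] c by simp
  have m_pos: "?m > 0"
    using low[OF m] A(2) by (cases "?m = 0") auto
  have "2 * ?M \<le> ?D * ?m"
    using up[OF M] low[OF m] by (simp add: algebra_simps)
  then have le: "2 * real ?M \<le> real ?D * real ?m"
    by (metis of_nat_le_iff of_nat_mult of_nat_numeral)
  then show "elasticity (lengths A) \<le> real ?D / 2"
    using m_pos by (simp add: elasticity_def field_simps)
  have "elasticity (lengths A) = real ?D / 2 \<longleftrightarrow> 2 * real ?M = real ?D * real ?m"
    using m_pos by (simp add: elasticity_def field_simps)
  also have "\<dots> \<longleftrightarrow> real (2 * ?M) = real (?D * ?m)"
    by simp
  also have "\<dots> \<longleftrightarrow> 2 * ?M = ?D * ?m"
    by (simp only: of_nat_eq_iff)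
  also have "\<dots> \<longleftrightarrow> (\<exists>k\<in>lengths A. 2 * k = size A) \<and> (\<exists>k\<in>lengths A. ?D * k = size A)"
  proof
    assume eq: "2 * ?M = ?D * ?m"
    have "(c + 2) * count A 0 \<le> count A 0"
      using up[OF M] low[OF m] eq by linarith
    then have "count A 0 = 0" by simp
    then have "2 * ?M = size A" "?D * ?m = size A"
      using up[OF M] low[OF m] eq by simp_all
    with M m show "(\<exists>k\<in>lengths A. 2 * k = size A) \<and> (\<exists>k\<in>lengths A. ?D * k = size A)" by blast
  next
    assume "(\<exists>k\<in>lengths A. 2 * k = size A) \<and> (\<exists>k\<in>lengths A. ?D * k = size A)"
    then obtain k l where kl: "k \<in> lengths A" "2 * k = size A" "l \<in> lengths A" "?D * l = size A"
      by blast
    have "(c + 2) * count A 0 = 0" using low[OF kl(3)] kl(4) by simp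
    then have "count A 0 = 0" by simp
    then have "?D * l \<le> ?D * ?m" using low[OF m] kl(4) by simp
    then have "l \<le> ?m" using c by simp
    then have "l = ?m" using Min_le[OF fin kl(3)] by simp
    moreover have "k = ?M"
      using \<open>count A 0 = 0\<close> kl(2) up[OF M] Max_ge[OF fin kl(1)] by simp
    ultimately have "k = ?M" "l = ?m" by simp_all
    then show "2 * ?M = ?D * ?m" using kl by simp
  qed
  finally show "elasticity (lengths A) = real ?D / 2 \<longleftrightarrow>
      (\<exists>k\<in>lengths A. 2 * k = size A) \<and> (\<exists>k\<in>lengths A. ?D * k = size A)" .
qed

text \<open>
  For an atom \<open>U\<close> of maximal size, \<open>U + (- U)\<close> is a product of two atoms of size \<open>D\<close> and also of
  \<open>D\<close> atoms \<open>{#g, - g#}\<close>; it attains the elasticity.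
\<close>

lemma extremal_symmetric_pair:
  fixes U :: "'g::{ab_group_add, finite} multiset"
  assumes D: "davenport TYPE('g) \<ge> 3" and U: "U \<in> minimal_zero_sum_seqs" "size U = davenport TYPE('g)"
  defines "A \<equiv> U + image_mset uminus U"
  shows "A \<in> zero_sum_seqs" "A \<noteq> {#}" "0 \<notin># U" "2 \<in> lengths A"
    "davenport TYPE('g) \<in> lengths A" "size A = 2 * davenport TYPE('g)"
proof -
  have neg: "image_mset uminus U \<in> minimal_zero_sum_seqs" using U(1) by (rule minimal_zero_sum_uminus)
  show "A \<in> zero_sum_seqs"
    unfolding A_def by (intro zero_sum_seqs_add minimal_zero_sum_in_zero_sum U(1) neg)
  show "A \<noteq> {#}" using D U(2) by (auto simp: A_def)
  show zero: "0 \<notin># U" using minimal_zero_sum_zero[OF U(1)] U(2) D by auto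
  show "2 \<in> lengths A"
    using lengths_add[OF atom_one_in_length_set[OF _ U(1)] atom_one_in_length_set[OF _ neg]]
    by (simp add: A_def numeral_2_eq_2)
  show "davenport TYPE('g) \<in> lengths A"
    using size_in_lengths_symmetric[OF zero] U(2) by (simp add: A_def)
  show "size A = 2 * davenport TYPE('g)" using U(2) by (simp add: A_def)
qed

lemma zero_sum_elasticity_eq:
  assumes D: "davenport TYPE('g::{ab_group_add, finite}) \<ge> 3"
  shows "zero_sum_elasticity TYPE('g) = real (davenport TYPE('g)) / 2"
proof -
  obtain U :: "'g multiset" where U: "U \<in> minimal_zero_sum_seqs" "size U = davenport TYPE('g)"
    by (rule ex_minimal_zero_sum_size_davenport)
  let ?A = "U + image_mset uminus U"
  note A = extremal_symmetric_pair[OF D U]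
  have attained: "elasticity (lengths ?A) = real (davenport TYPE('g)) / 2"
    unfolding elasticity_lengths_le(2)[OF D A(1,2)] using A(4-6) by auto
  show ?thesis
    unfolding zero_sum_elasticity_def
  proof (rule cSup_eq_maximum)
    show "real (davenport TYPE('g)) / 2 \<in> (\<lambda>A. elasticity (lengths A)) `
        ((zero_sum_seqs :: 'g multiset set) - {{#}})"
      using attained A(1,2) by (intro image_eqI[of _ _ ?A]) auto
    show "x \<le> real (davenport TYPE('g)) / 2"
      if "x \<in> (\<lambda>A. elasticity (lengths A)) ` ((zero_sum_seqs :: 'g multiset set) - {{#}})" for x
      using that elasticity_lengths_le(1)[OF D] by blast
  qed
qed

text \<open>
  Unlike the elasticity itself, the two conditions on the right are visibly additive in \<open>A\<close>; all
  further arguments work with them.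
\<close>

lemma max_elastic_seqs_iff:
  fixes A :: "'g::{ab_group_add, finite} multiset"
  assumes D: "davenport TYPE('g) \<ge> 3"
  shows "A \<in> max_elastic_seqs \<longleftrightarrow> A \<in> zero_sum_seqs \<and>
    (\<exists>k\<in>lengths A. 2 * k = size A) \<and> (\<exists>k\<in>lengths A. davenport TYPE('g) * k = size A)"
proof (cases "A = {#}")
  case True
  then show ?thesis
    by (auto simp: max_elastic_seqs_def zero_in_length_set_empty intro!: bexI[of _ 0])
next
  case False
  then show ?thesis
    using elasticity_lengths_le(2)[OF D _ False]
    by (auto simp: max_elastic_seqs_def zero_sum_elasticity_eq[OF D])
qed

lemma empty_in_max_elastic_seqs [simp]: "{#} \<in> max_elastic_seqs"
  by (simp add: max_elastic_seqs_def)

lemma max_elastic_seqs_add: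
  fixes A :: "'g::{ab_group_add, finite} multiset"
  assumes D: "davenport TYPE('g) \<ge> 3" and "A \<in> max_elastic_seqs" "B \<in> max_elastic_seqs"
  shows "A + B \<in> max_elastic_seqs"
proof -
  obtain k l k' l' where
    "k \<in> lengths A" "2 * k = size A" "l \<in> lengths A" "davenport TYPE('g) * l = size A"
    "k' \<in> lengths B" "2 * k' = size B" "l' \<in> lengths B" "davenport TYPE('g) * l' = size B"
    "A \<in> zero_sum_seqs" "B \<in> zero_sum_seqs"
    using assms(2,3) unfolding max_elastic_seqs_iff[OF D] by blast
  then show ?thesis
    unfolding max_elastic_seqs_iff[OF D]
    by (intro conjI bexI[of _ "k + k'"] bexI[of _ "l + l'"])
      (auto simp: lengths_add zero_sum_seqs_add add_mult_distrib2)
qed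

lemma max_elastic_seqs_repeat:
  fixes A :: "'g::{ab_group_add, finite} multiset"
  assumes "davenport TYPE('g) \<ge> 3" and "A \<in> max_elastic_seqs"
  shows "repeat_mset n A \<in> max_elastic_seqs"
  by (induction n) (simp_all add: assms max_elastic_seqs_add)

lemma zero_notin_max_elastic:
  fixes A :: "'g::{ab_group_add, finite} multiset"
  assumes D: "davenport TYPE('g) \<ge> 3" and "A \<in> max_elastic_seqs"
  shows "0 \<notin># A"
proof -
  obtain l where l: "l \<in> lengths A" "davenport TYPE('g) * l = size A"
    using assms(2) unfolding max_elastic_seqs_iff[OF D] by blast
  have "(davenport TYPE('g) - 1) * count A 0 = 0"
    using lengths_lower_weighted[OF l(1)] l(2) D by simp
  then show ?thesis using D by (simp add: not_in_iff)
qed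

lemma extremal_symmetric_pair_max_elastic:
  fixes U :: "'g::{ab_group_add, finite} multiset"
  assumes D: "davenport TYPE('g) \<ge> 3" and U: "U \<in> minimal_zero_sum_seqs" "size U = davenport TYPE('g)"
  shows "U + image_mset uminus U \<in> max_elastic_seqs"
  unfolding max_elastic_seqs_iff[OF D] using extremal_symmetric_pair[OF D U] by auto

section \<open>Finiteness of the set of atoms\<close>

text \<open>
  A pair of factorizations of the same sequence is recorded as one multiset of atoms labelled with
  a Boolean, so that Dickson's lemma applies to both factorizations at once.
\<close>

definition labelled :: "bool \<Rightarrow> (bool \<times> 'a) multiset \<Rightarrow> 'a multiset" where
  "labelled b w = image_mset snd {#p \<in># w. fst p = b#}"

lemma labelled_add: "labelled b (v + w) = labelled b v + labelled b w"
  by (simp add: labelled_def)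

lemma set_labelled: "set_mset w \<subseteq> UNIV \<times> S \<Longrightarrow> set_mset (labelled b w) \<subseteq> S"
  by (auto simp: labelled_def)

lemma labelled_image_Pair: "labelled b (image_mset (Pair b') z) = (if b = b' then z else {#})"
  by (simp add: labelled_def filter_mset_image_mset multiset.map_comp comp_def)

text \<open>
  To each \<open>A\<close> in the monoid attach a witness: a factorization of \<open>A\<close> of length \<open>size A / 2\<close>
  together with one of length \<open>size A / D\<close>.  If the witness of \<open>A\<close> is contained in that of \<open>B\<close>,
  the difference is a witness for the cofactor of \<open>A\<close> in \<open>B\<close>, so \<open>A\<close> divides \<open>B\<close> inside the
  monoid. Hence the witnesses of the atoms form an antichain, which is finite by Dickson's lemma.
\<close>

lemma finite_atoms_max_elastic:
  assumes D: "davenport TYPE('g::{ab_group_add, finite}) \<ge> 3"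
  shows "finite (atoms_in (max_elastic_seqs :: 'g multiset set))"
proof (rule ccontr)
  let ?D = "davenport TYPE('g)" and ?Z = "minimal_zero_sum_seqs :: 'g multiset set"
  let ?H = "max_elastic_seqs :: 'g multiset set"
  define wit where "wit A w \<longleftrightarrow> set_mset w \<subseteq> UNIV \<times> ?Z \<and>
    sum_mset (labelled True w) = A \<and> 2 * size (labelled True w) = size A \<and>
    sum_mset (labelled False w) = A \<and> ?D * size (labelled False w) = size A" for A w
  have ex_wit: "\<exists>w. wit A w" if "A \<in> ?H" for A
  proof -
    obtain k l where "k \<in> lengths A" "2 * k = size A" "l \<in> lengths A" "?D * l = size A"
      using \<open>A \<in> ?H\<close> unfolding max_elastic_seqs_iff[OF D] by blast
    then obtain y x where "set_mset y \<subseteq> ?Z" "sum_mset y = A" "2 * size y = size A"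
      "set_mset x \<subseteq> ?Z" "sum_mset x = A" "?D * size x = size A"
      unfolding in_lengths_iff by metis
    then have "wit A (image_mset (Pair True) y + image_mset (Pair False) x)"
      by (auto simp: wit_def labelled_add labelled_image_Pair)
    then show ?thesis by blast
  qed
  have diff: "B \<in> ?H" if "wit A v" "wit (A + B) (v + w)" for A B v w
  proof -
    have w: "set_mset w \<subseteq> UNIV \<times> ?Z"
      "sum_mset (labelled True w) = B" "2 * size (labelled True w) = size B"
      "sum_mset (labelled False w) = B" "?D * size (labelled False w) = size B"
      using that by (auto simp: wit_def labelled_add add_mult_distrib2)
    have "B \<in> zero_sum_seqs"
    proof -
      have "sum_mset z \<in> zero_sum_seqs" if "set_mset z \<subseteq> ?Z" for z
        using that by (induction z) (auto simp: zero_sum_seqs_add minimal_zero_sum_in_zero_sum)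
      then show ?thesis using set_labelled[OF w(1)] w(2) by metis
    qed
    moreover have "size (labelled b w) \<in> lengths (sum_mset (labelled b w))" for b
      unfolding in_lengths_iff using set_labelled[OF w(1)] by blast
    ultimately show ?thesis
      unfolding max_elastic_seqs_iff[OF D] using w by metis
  qed
  define f where "f A = (SOME w. wit A w)" for A
  have f: "wit A (f A)" if "A \<in> ?H" for A
    unfolding f_def using ex_wit[OF that] by (rule someI_ex)
  have atom_H: "A \<in> ?H" if "A \<in> atoms_in ?H" for A
    using that by (simp add: atoms_in_def)
  have f_inj: "inj_on f (atoms_in ?H)"
  proof (rule inj_onI)
    fix A B assume "A \<in> atoms_in ?H" "B \<in> atoms_in ?H" "f A = f B"
    then have "wit A (f A)" "wit B (f A)" using f atom_H by metis+
    then show "A = B" by (simp add: wit_def)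
  qed
  assume "infinite (atoms_in ?H)"
  then have "infinite (f ` atoms_in ?H)" using f_inj finite_imageD by blast
  moreover have "finite ((UNIV :: bool set) \<times> ?Z)" by (simp add: finite_minimal_zero_sum_seqs)
  moreover have "set_mset w \<subseteq> UNIV \<times> ?Z" if "w \<in> f ` atoms_in ?H" for w
    using that f atom_H unfolding wit_def by blast
  ultimately obtain v w where vw: "v \<in> f ` atoms_in ?H" "w \<in> f ` atoms_in ?H" "v \<noteq> w" "v \<subseteq># w"
    using Dickson[of "UNIV \<times> ?Z" "f ` atoms_in ?H"] by blast
  then obtain A B where AB: "A \<in> atoms_in ?H" "B \<in> atoms_in ?H" "f A \<noteq> f B" "f A \<subseteq># f B"
    by blast
  obtain u where u: "f B = f A + u" using AB(4) by (metis mset_subset_eq_exists_conv)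
  have wA: "wit A (f A)" and wB: "wit B (f A + u)"
    using f atom_H AB(1,2) u by metis+
  have "B = A + sum_mset (labelled True u)"
    using wA wB by (simp add: wit_def labelled_add)
  then obtain C where C: "B = A + C" by blast
  then have "C \<in> ?H" using diff wA wB by blast
  then have "A = {#} \<or> C = {#}"
    using AB(1,2) C atoms_in_multiset_monoid_iff[of ?H B] atom_H by auto
  moreover have "A \<noteq> {#}" using AB(1) atoms_in_multiset_monoid_iff[of ?H A] by auto
  ultimately show False using C AB(3) by auto
qed

section \<open>Gaps between lengths\<close>

lemma size_two_parts:
  fixes y :: "'a multiset multiset"
  assumes "\<And>u. u \<in># y \<Longrightarrow> 2 \<le> size u" "size (sum_mset y) \<le> 2 * size y"
  shows "\<forall>u\<in>#y. size u = 2"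
  using assms
proof (induction y)
  case (add u y)
  have "\<forall>v\<in>#y. 2 \<le> size v" using add.prems(1) by simp
  then have "2 * size y \<le> size (sum_mset y)" by (induction y) auto
  moreover have "2 \<le> size u" using add.prems(1) by simp
  ultimately have "size u = 2" "size (sum_mset y) \<le> 2 * size y" using add.prems(2) by simp_all
  moreover have "\<forall>v\<in>#y. size v = 2"
  proof (rule add.IH)
    show "2 \<le> size v" if "v \<in># y" for v using add.prems(1) that by simp
  qed fact
  ultimately show ?case by simp
qed simp

lemma max_elastic_pair_factorization:
  fixes A :: "'g::{ab_group_add, finite} multiset"
  assumes D: "davenport TYPE('g) \<ge> 3" and A: "A \<in> max_elastic_seqs"
  obtains y where "set_mset y \<subseteq> minimal_zero_sum_seqs" "\<forall>u\<in>#y. size u = 2" "sum_mset y = A"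
proof -
  obtain k where "k \<in> lengths A" "2 * k = size A"
    using A unfolding max_elastic_seqs_iff[OF D] by blast
  then obtain y where y: "set_mset y \<subseteq> minimal_zero_sum_seqs" "sum_mset y = A" "2 * size y = size A"
    unfolding in_lengths_iff by blast
  have "2 \<le> size u" if "u \<in># y" for u
  proof (rule minimal_zero_sum_size_ge_2)
    show "u \<in> minimal_zero_sum_seqs" using y(1) that by blast
    show "0 \<notin># u" using zero_notin_max_elastic[OF D A] that y(2) by auto
  qed
  then have "\<forall>u\<in>#y. size u = 2" using y by (intro size_two_parts) simp_all
  then show thesis using that y by blast
qed

text \<open>
  Beginning with any factorization of \<open>A\<close>, one reaches the one into pairs \<open>{#g, - g#}\<close> by steps
  which never shorten it and lengthen it by less than \<open>2 D\<close>; therefore the lengths above \<open>k\<close> have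
  bounded gaps.  One step deals with one pair \<open>p\<close>.  If \<open>p\<close> already occurs as a factor, cancel it.
  Otherwise \<open>g\<close> and \<open>- g\<close> lie in two different factors \<open>U\<close> and \<open>V\<close>, and \<open>U + V = p + W\<close> with a
  nonempty zero-sum sequence \<open>W\<close>, so \<open>U, V\<close> can be exchanged for \<open>p\<close> and the atoms of \<open>W\<close>.
\<close>

lemma bounded_gaps_to_pair_factorization:
  fixes A :: "'g::{ab_group_add, finite} multiset"
  assumes "set_mset y \<subseteq> minimal_zero_sum_seqs" "\<forall>u\<in>#y. size u = 2" "sum_mset y = A"
    and "k \<in> lengths A" "k \<le> t" "t \<le> size y"
  shows "\<exists>k'\<in>lengths A. k' \<le> t \<and> t \<le> k' + 2 * davenport TYPE('g)"
  using assms
proof (induction y arbitrary: A k t)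
  case empty
  then show ?case by (intro bexI[of _ k]) auto
next
  case (add p y)
  let ?D = "davenport TYPE('g)"
  define A' where "A' = sum_mset y"
  have A: "A = p + A'" using add.prems(3) by (simp add: A'_def)
  have p: "p \<in> minimal_zero_sum_seqs" using add.prems(1) by simp
  have "size p = 2" using add.prems(2) by simp
  then obtain g q where q: "p = add_mset g q"
    by (auto simp: numeral_2_eq_2 dest: size_eq_Suc_imp_eq_union)
  with \<open>size p = 2\<close> have "size q = 1" by simp
  then obtain h where "q = {#h#}" using size_1_singleton_mset by blast
  with q have "p = {#g, h#}" by simp
  then have pg: "p = {#g, - g#}"
    using p by (simp add: minimal_zero_sum_iff add_eq_0_iff)
  have IH: "\<exists>k'\<in>lengths A. k' \<le> t \<and> t \<le> k' + 2 * ?D"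
    if "j \<in> lengths A'" "j + 1 \<le> t" for j
  proof -
    have "\<exists>k'\<in>lengths A'. k' \<le> t - 1 \<and> t - 1 \<le> k' + 2 * ?D"
      using add.prems that by (intro add.IH[of A' j]) (auto simp: A'_def)
    then obtain k' where k': "k' \<in> lengths A'" "k' \<le> t - 1" "t - 1 \<le> k' + 2 * ?D" by blast
    have "1 + k' \<in> lengths A"
      unfolding A using lengths_add[OF atom_one_in_length_set[OF _ p] k'(1)] by simp
    then show ?thesis using k' that(2) by (intro bexI[of _ "1 + k'"]) auto
  qed
  obtain x where x: "set_mset x \<subseteq> minimal_zero_sum_seqs" "size x = k" "sum_mset x = A"
    using add.prems(4) unfolding in_lengths_iff by blast
  show ?case
  proof (cases "p \<in># x")
    case True
    then obtain x' where x': "x = add_mset p x'" by (metis mset_add)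
    then have "size x' \<in> lengths A'"
      unfolding in_lengths_iff using x A by (intro exI[of _ x']) auto
    moreover have "size x' + 1 \<le> t" using x' x(2) add.prems(5) by simp
    ultimately show ?thesis by (rule IH)
  next
    case False
    have "g \<in># sum_mset x" using x(3) A pg by simp
    then obtain U where U: "U \<in># x" "g \<in># U" by auto
    then obtain x' where x': "x = add_mset U x'" by (metis mset_add)
    have U_min: "U \<in> minimal_zero_sum_seqs" using U(1) x(1) by blast
    have not_sub: "\<not> p \<subseteq># W" "\<not> W \<subseteq># p" if "W \<in># x" for W
      using minimal_zero_sum_subset_eq[OF p, of W] minimal_zero_sum_subset_eq[OF _ p, of W]
        that x(1) False by auto
    \<comment> \<open>Otherwise \<open>U\<close> would contain both members of the pair, hence be equal to \<open>p\<close>.  For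
      \<open>g = - g\<close> this is about a second copy of \<open>g\<close>.\<close>
    have "- g \<in># sum_mset x'"
    proof (rule ccontr)
      assume "- g \<notin># sum_mset x'"
      moreover have "p \<subseteq># U + sum_mset x'" using x(3) x' A by (metis mset_subset_eq_add_left sum_mset.add_mset)
      moreover obtain U' where "U = add_mset g U'" using U(2) by (metis mset_add)
      ultimately have "{#- g#} \<subseteq># U' + sum_mset x'" "- g \<notin># sum_mset x'" "U = add_mset g U'"
        using pg by auto
      then have "p \<subseteq># U" using pg by auto
      then show False using not_sub(1) U(1) by blast
    qed
    then obtain V where V: "V \<in># x'" "- g \<in># V" by auto
    then obtain r where r: "x' = add_mset V r" by (metis mset_add)
    have V_min: "V \<in> minimal_zero_sum_seqs" using V(1) x' x(1) by auto
    obtain U' V' where UV': "U = add_mset g U'" "V = add_mset (- g) V'"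
      using U(2) V(2) by (metis mset_add)
    define W where "W = U' + V'"
    have UV: "U + V = p + W" by (simp add: UV' pg W_def)
    have "W \<in> zero_sum_seqs"
      using zero_sum_seqs_cancel[of p W] zero_sum_seqs_add[of U V] U_min V_min p
      by (simp add: UV minimal_zero_sum_in_zero_sum)
    then obtain w where w: "set_mset w \<subseteq> minimal_zero_sum_seqs" "sum_mset w = W"
      using ex_factorization[OF empty_in_zero_sum_seqs] by blast
    have "W \<noteq> {#}"
    proof
      assume "W = {#}"
      then have "U \<subseteq># p" using UV by (metis add.right_neutral mset_subset_eq_add_left)
      then show False using not_sub(2) U(1) by blast
    qed
    then have "size w \<ge> 1" using w(2) by (cases w) auto
    \<comment> \<open>The atoms being nonempty, \<open>W\<close> has at most \<open>size W \<le> 2 D - 2\<close> factors.\<close>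
    have "size w \<in> lengths W" unfolding in_lengths_iff using w by blast
    then have "size w \<le> size W" by (rule length_set_le_size[OF empty_in_zero_sum_seqs])
    also have "size W + 2 = size U + size V" by (simp add: UV' W_def)
    then have "size W + 2 \<le> 2 * ?D"
      using size_le_davenport[OF U_min] size_le_davenport[OF V_min] by linarith
    finally have w_le: "size w + 2 \<le> 2 * ?D" by simp
    have k: "k = size r + 2" using x(2) x' r by simp
    have "p + A' = p + (W + sum_mset r)"
      using A x(3) x' r UV by (metis add.assoc sum_mset.add_mset)
    then have "A' = sum_mset (w + r)" using w(2) by simp
    moreover have "set_mset (w + r) \<subseteq> minimal_zero_sum_seqs"
      using w(1) x(1) x' r by auto
    ultimately have step: "size w + size r \<in> lengths A'"
      unfolding in_lengths_iff by (intro exI[of _ "w + r"]) auto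
    show ?thesis
    proof (cases "size w + size r + 1 \<le> t")
      case True
      then show ?thesis by (rule IH[OF step])
    next
      case False
      then show ?thesis
        using add.prems(4,5) k w_le by (intro bexI[of _ k]) auto
    qed
  qed
qed

section \<open>Length sets that are intervals\<close>

lemma subset_mset_add_mset_notin:
  assumes "x \<subseteq># add_mset g S" "g \<notin># x"
  shows "x \<subseteq># S"
proof -
  have "count x a \<le> count S a" for a
    using assms by (cases "a = g") (auto simp: subseteq_mset_def not_in_iff dest!: spec[of _ a])
  then show ?thesis by (simp add: subseteq_mset_def)
qed

text \<open>
  A zero-sum subsequence using the merged element \<open>g + h\<close> corresponds to one of the original
  sequence using both \<open>g\<close> and \<open>h\<close>.
\<close>

lemma merge_pair_in_minimal_zero_sum:
  assumes "add_mset g (add_mset h T) \<in> minimal_zero_sum_seqs"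
  shows "add_mset (g + h) T \<in> minimal_zero_sum_seqs"
  unfolding minimal_zero_sum_iff
proof (intro conjI allI impI)
  let ?U = "add_mset g (add_mset h T)" and ?V = "add_mset (g + h) T"
  have U: "sum_mset ?U = 0" "\<And>X. X \<subseteq># ?U \<Longrightarrow> sum_mset X = 0 \<Longrightarrow> X = {#} \<or> X = ?U"
    using assms unfolding minimal_zero_sum_iff by blast+
  show "sum_mset ?V = 0" using U(1) by (simp add: add.assoc)
  show "?V \<noteq> {#}" by simp
  fix X assume X: "X \<subseteq># ?V" "sum_mset X = 0"
  show "X = {#} \<or> X = ?V"
  proof (cases "X \<subseteq># T")
    case True
    moreover have "T \<subseteq># ?U" using mset_subset_eq_add_right[of T "{#g, h#}"] by simp
    ultimately have "X \<subseteq># ?U" by (rule subset_mset.order_trans)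
    then have "X = {#} \<or> X = ?U" using U(2) X(2) by blast
    moreover have "size X \<le> size T" using True by (rule size_mset_mono)
    ultimately show ?thesis by auto
  next
    case False
    then have "g + h \<in># X" using subset_mset_add_mset_notin[OF X(1)] by blast
    then obtain X' where X': "X = add_mset (g + h) X'" by (metis mset_add)
    have "add_mset g (add_mset h X') \<subseteq># ?U" using X(1) X' by simp
    moreover have "sum_mset (add_mset g (add_mset h X')) = 0" using X(2) X' by (simp add: add.assoc)
    ultimately have "add_mset g (add_mset h X') = ?U"
      using U(2)[of "add_mset g (add_mset h X')"] by simp
    then show ?thesis using X' by simp
  qed
qed

lemma sum_subset_add_mset_cases:
  assumes "x + y \<subseteq># add_mset g S"
  shows "x \<subseteq># S \<or> y \<subseteq># S"
proof (cases "g \<in># x")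
  case True
  then obtain x' where "x = add_mset g x'" by (metis mset_add)
  then have "x' + y \<subseteq># S" using assms by simp
  then show ?thesis by (meson mset_subset_eq_add_right subset_mset.order_trans)
next
  case False
  have sub: "x \<subseteq># add_mset g S" using assms by (meson mset_subset_eq_add_left subset_mset.order_trans)
  show ?thesis using subset_mset_add_mset_notin[OF sub False] ..
qed

text \<open>
  Splitting an element of a longest atom makes it too long to be an atom, so it decomposes.  It
  has exactly two factors: \<open>S\<close> has no nonempty zero-sum subsequence, hence every factor must
  contain one of the two new elements \<open>g\<close> and \<open>h\<close>.
\<close>

lemma split_sum_two_atoms:
  fixes S :: "'g::{ab_group_add, finite} multiset"
  assumes V: "add_mset (g + h) S \<in> minimal_zero_sum_seqs"
    and long: "davenport TYPE('g) < size S + 2"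
  shows "2 \<in> lengths (add_mset g (add_mset h S))"
proof -
  let ?W = "add_mset g (add_mset h S)"
  have free: "X = {#}" if "X \<subseteq># S" "sum_mset X = 0" for X
  proof -
    have "X \<subseteq># add_mset (g + h) S"
      using that(1) mset_subset_eq_add_right[of S "{#g + h#}"] by (simp add: subset_mset.order_trans)
    then have "X = {#} \<or> X = add_mset (g + h) S"
      using V that(2) unfolding minimal_zero_sum_iff by blast
    moreover have "size X \<le> size S" using that(1) by (rule size_mset_mono)
    ultimately show ?thesis by auto
  qed
  have "sum_mset (add_mset (g + h) S) = 0" using V unfolding minimal_zero_sum_iff by blast
  then have W: "?W \<in> zero_sum_seqs" by (simp add: zero_sum_seqs_def add.assoc)
  then obtain z where z: "set_mset z \<subseteq> minimal_zero_sum_seqs" "sum_mset z = ?W"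
    using ex_factorization[OF empty_in_zero_sum_seqs] by blast
  have "g \<in># sum_mset z" using z(2) by simp
  then obtain a where a: "a \<in># z" "g \<in># a" by auto
  then obtain z' where z': "z = add_mset a z'" by (metis mset_add)
  define b where "b = sum_mset z'"
  have W_eq: "?W = a + b" using z(2) z' by (simp add: b_def)
  have a_min: "a \<in> minimal_zero_sum_seqs" using z(1) a(1) by blast
  obtain a' where a': "a = add_mset g a'" using a(2) by (metis mset_add)
  have b_sub: "b \<subseteq># add_mset h S" using W_eq a' by (metis add_mset_add_mset_same_iff union_mset_add_mset_left mset_subset_eq_add_right)
  have "b \<in> zero_sum_seqs"
    using W W_eq a_min zero_sum_seqs_cancel[of a b] by (simp add: minimal_zero_sum_in_zero_sum)
  moreover have "b \<noteq> {#}"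
  proof
    assume "b = {#}"
    then have "size a = size S + 2" using W_eq by (metis add.right_neutral size_add_mset add_2_eq_Suc')
    then show False using size_le_davenport[OF a_min] long by simp
  qed
  moreover have "x = {#} \<or> y = {#}" if "x \<in> zero_sum_seqs" "y \<in> zero_sum_seqs" "b = x + y" for x y
    using sum_subset_add_mset_cases[of x y h S] b_sub that free by (auto simp: zero_sum_seqs_def)
  ultimately have b_min: "b \<in> minimal_zero_sum_seqs"
    by (simp add: atoms_in_multiset_monoid_iff)
  have "1 + 1 \<in> lengths (a + b)"
    by (intro lengths_add atom_one_in_length_set empty_in_zero_sum_seqs a_min b_min)
  then show ?thesis unfolding W_eq by (simp add: numeral_2_eq_2)
qed

text \<open>
  The sequence \<open>C\<close> is \<open>U (- U) V (- V)\<close>.  Its extreme lengths are \<open>4\<close> and \<open>2 D\<close>.  Moving the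
  splitting \<open>g + h \<leftrightarrow> g, h\<close> from \<open>U\<close> to \<open>V\<close> replaces the two atoms \<open>U, V\<close> by three, which gives
  length \<open>5\<close>.  Replacing the three pairs of \<open>g\<close>, \<open>h\<close> and \<open>g + h\<close> by the atom of \<open>g\<close>, \<open>h\<close>,
  \<open>- (g + h)\<close> and its negative gives length \<open>2 D - 1\<close>.
\<close>

lemma consecutive_lengths_at_both_ends:
  fixes g h :: "'g::{ab_group_add, finite}"
  assumes D: "davenport TYPE('g) \<ge> 3"
    and U: "U \<in> minimal_zero_sum_seqs" "size U = davenport TYPE('g)" "{#g, h#} \<subseteq># U"
    and V: "V \<in> minimal_zero_sum_seqs" "size V = davenport TYPE('g)" "{#g + h#} \<subseteq># V"
  obtains C :: "'g multiset" where "C \<in> max_elastic_seqs" "size C = 4 * davenport TYPE('g)"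
    "4 \<in> lengths C" "4 + 1 \<in> lengths C"
    "2 * davenport TYPE('g) - 1 \<in> lengths C" "2 * davenport TYPE('g) - 1 + 1 \<in> lengths C"
proof -
  let ?D = "davenport TYPE('g)"
  let ?neg = "image_mset uminus :: 'g multiset \<Rightarrow> 'g multiset"
  obtain T where T: "U = add_mset g (add_mset h T)"
    using U(3) by (auto simp: mset_subset_eq_exists_conv)
  obtain S where S: "V = add_mset (g + h) S"
    using V(3) by (auto simp: mset_subset_eq_exists_conv)
  note PU = extremal_symmetric_pair[OF D U(1,2)]
  note PV = extremal_symmetric_pair[OF D V(1,2)]
  define C where "C = (U + ?neg U) + (V + ?neg V)"
  have 1: "C \<in> max_elastic_seqs"
    unfolding C_def
    by (intro max_elastic_seqs_add[OF D] extremal_symmetric_pair_max_elastic[OF D] U(1,2) V(1,2))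
  have 2: "size C = 4 * ?D" using U(2) V(2) by (simp add: C_def)
  have 3: "4 \<in> lengths C"
    using lengths_add[OF PU(4) PV(4)] by (simp add: C_def)
  have "1 + 2 \<in> lengths (add_mset (g + h) T + add_mset g (add_mset h S))"
  proof (intro lengths_add atom_one_in_length_set empty_in_zero_sum_seqs)
    show "add_mset (g + h) T \<in> minimal_zero_sum_seqs"
      using U(1) unfolding T by (rule merge_pair_in_minimal_zero_sum)
    show "2 \<in> lengths (add_mset g (add_mset h S))"
      using V(1,2) unfolding S by (intro split_sum_two_atoms) auto
  qed
  moreover have "1 + 1 \<in> lengths (?neg U + ?neg V)"
    by (intro lengths_add atom_one_in_length_set empty_in_zero_sum_seqs
        minimal_zero_sum_uminus U(1) V(1))
  ultimately have "(1 + 2) + (1 + 1) \<in> lengths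
      ((add_mset (g + h) T + add_mset g (add_mset h S)) + (?neg U + ?neg V))"
    by (rule lengths_add)
  also have "(add_mset (g + h) T + add_mset g (add_mset h S)) + (?neg U + ?neg V) = C"
    by (simp add: C_def T S)
  finally have 4: "4 + 1 \<in> lengths C" by (simp add: numeral_eq_Suc)
  have 5: "2 * ?D - 1 + 1 \<in> lengths C"
    using lengths_add[OF PU(5) PV(5)] D by (simp add: C_def mult_2)
  define N where "N = {#g, h, - (g + h)#}"
  have N: "N \<in> minimal_zero_sum_seqs"
    unfolding N_def
  proof (rule small_zero_sum_is_minimal)
    have "g \<noteq> 0" "h \<noteq> 0" "g + h \<noteq> 0" using PU(3) PV(3) unfolding T S by auto
    then show "0 \<notin># {#g, h, - (g + h)#}" by (auto simp: neg_equal_0_iff_equal)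
  qed (simp_all add: algebra_simps)
  have "0 \<notin># T + S" using PU(3) PV(3) unfolding T S by auto
  then have "size (T + S) \<in> lengths ((T + S) + ?neg (T + S))"
    by (rule size_in_lengths_symmetric)
  moreover have "1 + 1 \<in> lengths (N + ?neg N)"
    by (intro lengths_add atom_one_in_length_set empty_in_zero_sum_seqs
        minimal_zero_sum_uminus N)
  ultimately have "(1 + 1) + size (T + S) \<in> lengths ((N + ?neg N) + ((T + S) + ?neg (T + S)))"
    by (rule lengths_add[rotated])
  also have "(N + ?neg N) + ((T + S) + ?neg (T + S)) = C"
    by (simp add: C_def T S N_def)
  also have "(1 + 1) + size (T + S) = 2 * ?D - 1"
    using U(2) V(2) unfolding T S by simp
  finally have 6: "2 * ?D - 1 \<in> lengths C" .
  show thesis by (rule that[OF 1 2 3 4 6 5])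
qed

text \<open>
  Let \<open>B\<close> be \<open>A\<close> times the \<open>M\<close>-th power \<open>R\<close> of \<open>C\<close>.  The lengths of \<open>B\<close> reach from \<open>p\<close> to \<open>q\<close>, and
  every number in between exceeds one of them by at most \<open>M\<close>.  The lengths of \<open>R\<close> contain a run of
  \<open>M + 1\<close> consecutive numbers at the lower end and another one at the upper end.  Adding the lower
  run to the lengths of \<open>B\<close> fills everything from the minimum \<open>4 M + p\<close> of \<open>R + B\<close> up to
  \<open>5 M + q\<close>, and adding the upper run fills the rest up to the maximum \<open>2 D M + q\<close>.
\<close>

lemma lengths_interval_of_consecutive:
  fixes A C :: "'g::{ab_group_add, finite} multiset"
  assumes D: "davenport TYPE('g) \<ge> 3"
    and C: "C \<in> max_elastic_seqs" "size C = 4 * davenport TYPE('g)"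
      "4 \<in> lengths C" "4 + 1 \<in> lengths C"
      "2 * davenport TYPE('g) - 1 \<in> lengths C" "2 * davenport TYPE('g) - 1 + 1 \<in> lengths C"
    and A: "A \<in> max_elastic_seqs"
  defines "M \<equiv> 2 * davenport TYPE('g)"
  shows "is_interval_set (lengths (repeat_mset (2 * M) C + A))"
proof -
  let ?D = "davenport TYPE('g)"
  define R where "R = repeat_mset M C"
  define B where "B = R + A"
  have R: "R \<in> max_elastic_seqs" unfolding R_def by (rule max_elastic_seqs_repeat[OF D C(1)])
  have B: "B \<in> max_elastic_seqs" unfolding B_def by (rule max_elastic_seqs_add[OF D R A])
  have X: "repeat_mset (2 * M) C + A = R + B"
    by (simp add: R_def B_def mult_2 repeat_mset_distrib2 repeat_mset_distrib)
  have RB: "R + B \<in> max_elastic_seqs" by (rule max_elastic_seqs_add[OF D R B])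
  obtain y where y: "set_mset y \<subseteq> minimal_zero_sum_seqs" "\<forall>u\<in>#y. size u = 2" "sum_mset y = B"
    using max_elastic_pair_factorization[OF D B] .
  define q where "q = size y"
  have q_len: "q \<in> lengths B" unfolding in_lengths_iff q_def using y by blast
  have q: "2 * q = size B"
  proof -
    have "size (sum_mset y) = 2 * size y" using y(2) by (induction y) auto
    then show ?thesis using y(3) by (simp add: q_def)
  qed
  obtain p where p: "p \<in> lengths B" "?D * p = size B"
    using B unfolding max_elastic_seqs_iff[OF D] by blast
  \<comment> \<open>Since \<open>q\<close> is the length of a factorization into pairs, the gap bound applies on all of
    \<open>[p, q]\<close>.\<close>
  have gap: "\<exists>k\<in>lengths B. k \<le> t \<and> t \<le> k + M" if "p \<le> t" "t \<le> q" for t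
    unfolding M_def using that p(1) y
    by (intro bounded_gaps_to_pair_factorization[of y B p]) (auto simp: q_def)
  have size_RB: "size (R + B) = 4 * ?D * M + size B"
    by (simp add: R_def C(2))
  have low: "t \<in> lengths R" if "4 * M \<le> t" "t \<le> 5 * M" for t
    unfolding R_def using that
    by (intro length_set_repeat_consecutive[OF _ C(3,4)]) auto
  have high: "t \<in> lengths R" if "(2 * ?D - 1) * M \<le> t" "t \<le> 2 * ?D * M" for t
  proof -
    have "2 * ?D * M = (2 * ?D - 1) * M + M" using D by (simp add: algebra_simps diff_mult_distrib)
    then show ?thesis
      unfolding R_def using that
      by (intro length_set_repeat_consecutive[OF _ C(5,6)]) (auto simp: mult.commute)
  qed
  have size_B: "size B = 4 * ?D * M + size A" by (simp add: B_def R_def C(2))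
  \<comment> \<open>Here \<open>p - 4 M\<close> is \<open>size A / D\<close> and \<open>q - 2 D M\<close> is \<open>size A / 2\<close>.  The bound ensures that the
    upper run is only needed at positions where its target lies above \<open>p\<close>.\<close>
  have p_bound: "p \<le> 4 * M + (q - 2 * ?D * M)"
  proof -
    have "3 * (p - 4 * M) \<le> ?D * (p - 4 * M)" using D by simp
    also have "\<dots> = size A"
      using p(2) size_B by (simp add: diff_mult_distrib2)
    also have "size A = 2 * (q - 2 * ?D * M)" using q size_B by simp
    finally show ?thesis by linarith
  qed
  have "lengths (R + B) = {4 * M + p..2 * ?D * M + q}"
  proof (intro equalityI subsetI)
    fix t assume t: "t \<in> lengths (R + B)"
    have "count (R + B) 0 = 0" using zero_notin_max_elastic[OF D RB] by (simp add: not_in_iff)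
    then have "2 * t \<le> size (R + B)" "size (R + B) \<le> ?D * t"
      using lengths_upper_weighted[OF t] lengths_lower_weighted[OF t] D by simp_all
    then have "2 * t \<le> 2 * (2 * ?D * M + q)" "?D * (4 * M + p) \<le> ?D * t"
      unfolding size_RB using p(2) q by (simp_all add: algebra_simps)
    then show "t \<in> {4 * M + p..2 * ?D * M + q}" using D by simp
  next
    fix t assume t: "t \<in> {4 * M + p..2 * ?D * M + q}"
    have split: "t \<in> lengths (R + B)" if "k \<in> lengths B" "k \<le> t" "t - k \<in> lengths R" for k
      using lengths_add[OF that(3,1)] that(2) by simp
    show "t \<in> lengths (R + B)"
    proof (cases "t \<le> 4 * M + q")
      case True
      then have "p \<le> t - 4 * M" "t - 4 * M \<le> q" using t by auto
      from gap[OF this] obtain k where "k \<in> lengths B" "k \<le> t - 4 * M" "t - 4 * M \<le> k + M"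
        by blast
      moreover have "4 * M \<le> t" using t by simp
      ultimately show ?thesis by (intro split[of k] low) auto
    next
      case False
      let ?e = "(2 * ?D - 1) * M"
      have e: "?e + M = 2 * ?D * M" using D by (simp add: algebra_simps diff_mult_distrib)
      have qM: "2 * ?D * M \<le> q" using q size_B by simp
      have p_t: "p + ?e \<le> t" using False p_bound e qM by linarith
      show ?thesis
      proof (cases "t - ?e \<le> q")
        case True
        have "p \<le> t - ?e" using p_t by linarith
        from gap[OF this True] obtain k where "k \<in> lengths B" "k \<le> t - ?e" "t - ?e \<le> k + M"
          by blast
        then show ?thesis using p_t e by (intro split[of k] high) linarith+
      next
        case False
        then show ?thesis using q_len t by (intro split[of q] high) auto
      qed
    qed
  qed
  moreover have "lengths (R + B) \<noteq> {}"
    using RB unfolding max_elastic_seqs_iff[OF D] by blast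
  ultimately have "lengths (R + B) = {4 * M + p..2 * ?D * M + q}" "4 * M + p \<le> 2 * ?D * M + q"
    by simp_all
  then show ?thesis
    unfolding X is_interval_set_def by blast
qed

section \<open>Asymptotics\<close>

text \<open>
  As the monoid is closed under addition, the elements with a given length are precisely the sums
  of that many atoms, which brings the counting into the scope of Khovanskii's theorem.
\<close>

lemma max_elastic_length_fibre:
  assumes D: "davenport TYPE('g::{ab_group_add, finite}) \<ge> 3"
  shows "{A \<in> (max_elastic_seqs :: 'g multiset set). n \<in> length_set max_elastic_seqs A} =
    fold_sums (atoms_in max_elastic_seqs) n"
proof -
  have "sum_list us \<in> max_elastic_seqs" if "set us \<subseteq> atoms_in max_elastic_seqs" for us :: "'g multiset list"
    using that by (induction us) (auto intro!: max_elastic_seqs_add[OF D] simp: atoms_in_def)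
  then show ?thesis
    by (auto simp: fold_sums_def in_length_set_iff_list)
qed

lemma finite_fold_sums: "finite A \<Longrightarrow> finite (fold_sums A n)"
proof -
  assume "finite A"
  then have "finite (sum_list ` {us. set us \<subseteq> A \<and> length us = n})"
    by (intro finite_imageI finite_lists_length_eq)
  moreover have "fold_sums A n = sum_list ` {us. set us \<subseteq> A \<and> length us = n}"
    by (auto simp: fold_sums_def)
  ultimately show ?thesis by simp
qed

lemma fold_sums_nonempty: "A \<noteq> {} \<Longrightarrow> fold_sums A n \<noteq> {}"
proof -
  assume "A \<noteq> {}"
  then obtain a where "a \<in> A" by blast
  then have "sum_list (replicate n a) \<in> fold_sums A n"
    unfolding fold_sums_def by (intro CollectI exI[of _ "replicate n a"]) auto
  then show ?thesis by blast
qed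

lemma fold_sums_add:
  assumes "x \<in> fold_sums A k" "y \<in> fold_sums A m"
  shows "x + y \<in> fold_sums A (k + m)"
proof -
  obtain us vs where "x = sum_list us" "set us \<subseteq> A" "length us = k"
    "y = sum_list vs" "set vs \<subseteq> A" "length vs = m"
    using assms by (auto simp: fold_sums_def)
  then show ?thesis unfolding fold_sums_def by (intro CollectI exI[of _ "us @ vs"]) auto
qed

theorem corollary3p8:
  assumes "CARD('g::{ab_group_add, finite}) \<ge> 3"
  shows
    "(\<forall>k\<^sub>0::nat.
       (\<lambda>n. real (card {A \<in> (max_elastic_seqs :: 'g multiset set).
                          n - k\<^sub>0 \<in> length_set max_elastic_seqs A})
          / real (card {A \<in> (max_elastic_seqs :: 'g multiset set).
                          n \<in> length_set max_elastic_seqs A}))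
       \<longlonglongrightarrow> 1)
     \<and> ((\<exists>g\<^sub>1 g\<^sub>2 :: 'g. \<exists>U\<^sub>1 \<in> minimal_zero_sum_seqs. \<exists>U\<^sub>2 \<in> minimal_zero_sum_seqs.
           size U\<^sub>1 = davenport TYPE('g) \<and> size U\<^sub>2 = davenport TYPE('g) \<and>
           {#g\<^sub>1, g\<^sub>2#} \<subseteq># U\<^sub>1 \<and> {#g\<^sub>1 + g\<^sub>2#} \<subseteq># U\<^sub>2)
        \<longrightarrow>
       (\<lambda>n. real (card {A \<in> (max_elastic_seqs :: 'g multiset set).
                          is_interval_set (length_set zero_sum_seqs A) \<and>
                          n \<in> length_set max_elastic_seqs A})
          / real (card {A \<in> (max_elastic_seqs :: 'g multiset set).
                          n \<in> length_set max_elastic_seqs A}))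
       \<longlonglongrightarrow> 1)"
proof -
  have D: "davenport TYPE('g) \<ge> 3" using assms by (rule davenport_ge_3)
  let ?H = "max_elastic_seqs :: 'g multiset set"
  define F where "F = fold_sums (atoms_in ?H)"
  have fibre: "{A \<in> ?H. n \<in> length_set ?H A} = F n" for n
    unfolding F_def by (rule max_elastic_length_fibre[OF D])
  have fin: "finite (F n)" for n
    unfolding F_def by (intro finite_fold_sums finite_atoms_max_elastic[OF D])
  have "atoms_in ?H \<noteq> {}"
  proof -
    obtain U :: "'g multiset" where U: "U \<in> minimal_zero_sum_seqs" "size U = davenport TYPE('g)"
      by (rule ex_minimal_zero_sum_size_davenport)
    obtain z where "set_mset z \<subseteq> atoms_in ?H" "sum_mset z = U + image_mset uminus U"
      using ex_factorization[OF _ extremal_symmetric_pair_max_elastic[OF D U]] by auto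
    then show ?thesis using extremal_symmetric_pair(2)[OF D U] by auto
  qed
  then have card_pos: "real (card (F n)) > 0" for n
    using fold_sums_nonempty[of "atoms_in ?H" n] fin[of n] by (simp add: F_def card_gt_0_iff)
  have ratio: "(\<lambda>n. real (card (F (n - k))) / real (card (F n))) \<longlonglongrightarrow> 1" for k
  proof (rule eventually_polynomial_ratio)
    show "eventually_polynomial (\<lambda>n. real (card (F n)))"
      unfolding F_def by (intro Khovanskii finite_atoms_max_elastic[OF D])
    show "real (card (F n)) \<noteq> 0" for n using card_pos[of n] by simp
  qed
  define I where "I n = {A \<in> ?H. is_interval_set (lengths A) \<and> n \<in> length_set ?H A}" for n
  have I_sub: "I n \<subseteq> F n" for n using fibre[of n] by (auto simp: I_def)
  have "(\<lambda>n. real (card (I n)) / real (card (F n))) \<longlonglongrightarrow> 1"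
    if ex: "\<exists>g h :: 'g. \<exists>U \<in> minimal_zero_sum_seqs. \<exists>V \<in> minimal_zero_sum_seqs.
        size U = davenport TYPE('g) \<and> size V = davenport TYPE('g) \<and>
        {#g, h#} \<subseteq># U \<and> {#g + h#} \<subseteq># V"
  proof -
    obtain g h :: 'g and U V where
      U: "U \<in> minimal_zero_sum_seqs" "size U = davenport TYPE('g)" "{#g, h#} \<subseteq># U" and
      V: "V \<in> minimal_zero_sum_seqs" "size V = davenport TYPE('g)" "{#g + h#} \<subseteq># V"
      using ex by blast
    obtain C :: "'g multiset" where C: "C \<in> max_elastic_seqs" "size C = 4 * davenport TYPE('g)"
      "4 \<in> lengths C" "4 + 1 \<in> lengths C"
      "2 * davenport TYPE('g) - 1 \<in> lengths C" "2 * davenport TYPE('g) - 1 + 1 \<in> lengths C"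
      by (rule consecutive_lengths_at_both_ends[OF D U V])
    define X where "X = repeat_mset (2 * (2 * davenport TYPE('g))) C"
    have X: "X \<in> ?H" unfolding X_def by (rule max_elastic_seqs_repeat[OF D C(1)])
    have interval: "is_interval_set (lengths (X + A))" if "A \<in> ?H" for A
      unfolding X_def by (rule lengths_interval_of_consecutive[OF D C that])
    obtain k where "k \<in> length_set ?H X"
      using length_set_nonempty[OF empty_in_max_elastic_seqs X] by blast
    then have Xk: "X \<in> F k" using X fibre[of k] by blast
    \<comment> \<open>Translation by \<open>X\<close> embeds the \<open>(n - k)\<close>-fold sumset into the set with interval length
      sets.\<close>
    have lower: "card (F (n - k)) \<le> card (I n)" if "k \<le> n" for n
    proof -
      have "(+) X ` F (n - k) \<subseteq> I n"
      proof
        fix Y assume "Y \<in> (+) X ` F (n - k)"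
        then obtain A where A: "A \<in> F (n - k)" "Y = X + A" by blast
        then have "A \<in> ?H" using fibre[of "n - k"] by blast
        moreover have "Y \<in> F n"
          using fold_sums_add[OF Xk[unfolded F_def] A(1)[unfolded F_def]] A(2) that
          by (simp add: F_def)
        ultimately show "Y \<in> I n" using interval A(2) fibre[of n] by (auto simp: I_def)
      qed
      moreover have "finite (I n)" using I_sub fin finite_subset by blast
      ultimately have "card ((+) X ` F (n - k)) \<le> card (I n)" by (intro card_mono)
      then show ?thesis by (simp add: card_image)
    qed
    show ?thesis
    proof (rule tendsto_sandwich[OF _ _ ratio[of k] tendsto_const])
      show "\<forall>\<^sub>F n in sequentially.
          real (card (F (n - k))) / real (card (F n)) \<le> real (card (I n)) / real (card (F n))"
        using eventually_ge_at_top[of k]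
        by eventually_elim (use lower in \<open>auto intro: divide_right_mono\<close>)
      show "\<forall>\<^sub>F n in sequentially. real (card (I n)) / real (card (F n)) \<le> 1"
        using card_pos card_mono[OF fin I_sub] by (intro always_eventually) (auto simp: divide_le_eq_1)
    qed
  qed
  then show ?thesis
    using ratio unfolding fibre I_def by blast
qed

end
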